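(* There is a universal constant $C>0$ such that the following holds in every dimension $d$. Let $\pi$ be the uniform distribution over one of the following isotropic convex bodies in $\mathbb{R}^d$: (i) the isotropic hypercube $[-\sqrt3,\sqrt3]^d$; (ii) the regular $d$-simplex in isotropic position; (iii) any isotropic convex body of revolution. Then $\pi$ is $C$-quadratic-tilt stable, that is, $\|\operatorname{cov}\pi\gamma_t\|\le C$ for all $t>0$.
   Context: $\gamma_t$ is the centered Gaussian on $\mathbb{R}^d$ with covariance $tI_d$, and $\pi\gamma_t$ denotes the probability measure with density proportional to the product of the densities of $\pi$ and $\gamma_t$, i.e. $\pi\gamma_t(dx)\propto e^{-|x|^2/(2t)}\,\pi(dx)$. A probability measure $\pi$ on $\mathbb{R}^d$ is $\lambda$-quadratic-tilt stable if $\|\operatorname{cov}\pi\gamma_t\|\le\lambda$ for every $t>0$ (operator norm). A convex body is isotropic if its uniform distribution has barycenter at the origin and identity covariance. A convex body of revolution is a convex body of the form $\{(s,y)\in\mathbb{R}\times\mathbb{R}^{d-1}:s\in I,\ |y|\le r(s)\}$, where $I\subset\mathbb{R}$ is an interval and $r$ is a nonnegative concave function on $I$. *)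

theory Defs
  imports "HOL-Analysis.Analysis" "HOL-Probability.Probability"
begin

text \<open>
  The constant in the theorem does not depend on the dimension, and a HOL formula cannot
  quantify over types, so \<open>\<real>\<^sup>d\<close> is modelled with \<open>d\<close> a natural number: its points are the
  extensional functions on \<open>{..<d}\<close>, its topology is the product topology, its Lebesgue
  measure is the product measure, and the Euclidean norm of \<open>x\<close> is \<open>L2_set x {..<d}\<close>.
\<close>

abbreviation Rd :: "nat \<Rightarrow> (nat \<Rightarrow> real) set" where
  "Rd d \<equiv> {..<d} \<rightarrow>\<^sub>E UNIV"

abbreviation lborel_Rd :: "nat \<Rightarrow> (nat \<Rightarrow> real) measure" where
  "lborel_Rd d \<equiv> \<Pi>\<^sub>M i\<in>{..<d}. lborel"

text \<open>\<open>d \<times> d\<close> matrices are functions of two indices, of which only the entries with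
  indices below \<open>d\<close> matter.\<close>

definition op_norm :: "nat \<Rightarrow> (nat \<Rightarrow> nat \<Rightarrow> real) \<Rightarrow> real" where
  "op_norm d A =
     (SUP v\<in>{v \<in> Rd d. L2_set v {..<d} \<le> 1}. L2_set (\<lambda>i. \<Sum>j<d. A i j * v j) {..<d})"

definition barycenter :: "(nat \<Rightarrow> real) measure \<Rightarrow> nat \<Rightarrow> real" where
  "barycenter M i = (LINT x|M. x i)"

definition cov :: "(nat \<Rightarrow> real) measure \<Rightarrow> nat \<Rightarrow> nat \<Rightarrow> real" where
  "cov M i j = (LINT x|M. (x i - barycenter M i) * (x j - barycenter M j))"

text \<open>The probability measure \<open>\<pi>\<gamma>\<^sub>t\<close>, for \<open>t > 0\<close> and \<open>\<pi>\<close> a probability measure on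
  \<open>\<real>\<^sup>d\<close>. The weight is bounded and positive, so the normalizing constant is finite and
  positive; its Gaussian decay makes all moments of \<open>\<pi>\<gamma>\<^sub>t\<close> finite.\<close>

definition gauss_tilt :: "nat \<Rightarrow> real \<Rightarrow> (nat \<Rightarrow> real) measure \<Rightarrow> (nat \<Rightarrow> real) measure" where
  "gauss_tilt d t M =
     density M (\<lambda>x. ennreal (exp (- (L2_set x {..<d})\<^sup>2 / (2 * t)) /
                             (LINT y|M. exp (- (L2_set y {..<d})\<^sup>2 / (2 * t)))))"

definition quadratic_tilt_stable :: "nat \<Rightarrow> real \<Rightarrow> (nat \<Rightarrow> real) measure \<Rightarrow> bool" where
  "quadratic_tilt_stable d c M \<longleftrightarrow>
     prob_space M \<and> sets M = sets (lborel_Rd d) \<and>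
     (\<forall>t>0. op_norm d (cov (gauss_tilt d t M)) \<le> c)"

definition convex_Rd :: "nat \<Rightarrow> (nat \<Rightarrow> real) set \<Rightarrow> bool" where
  "convex_Rd d K \<longleftrightarrow>
     K \<subseteq> Rd d \<and>
     (\<forall>x\<in>K. \<forall>y\<in>K. \<forall>u\<in>{0..1}. (\<lambda>i\<in>{..<d}. (1 - u) * x i + u * y i) \<in> K)"

definition convex_body :: "nat \<Rightarrow> (nat \<Rightarrow> real) set \<Rightarrow> bool" where
  "convex_body d K \<longleftrightarrow>
     convex_Rd d K \<and> compactin (powertop_real {..<d}) K \<and>
     powertop_real {..<d} interior_of K \<noteq> {}"

definition uniform_on :: "nat \<Rightarrow> (nat \<Rightarrow> real) set \<Rightarrow> (nat \<Rightarrow> real) measure" where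
  "uniform_on d K = uniform_measure (lborel_Rd d) K"

definition isotropic_body :: "nat \<Rightarrow> (nat \<Rightarrow> real) set \<Rightarrow> bool" where
  "isotropic_body d K \<longleftrightarrow>
     convex_body d K \<and>
     (\<forall>i<d. barycenter (uniform_on d K) i = 0) \<and>
     (\<forall>i<d. \<forall>j<d. cov (uniform_on d K) i j = (if i = j then 1 else 0))"

definition isotropic_cube :: "nat \<Rightarrow> (nat \<Rightarrow> real) set" where
  "isotropic_cube d = {..<d} \<rightarrow>\<^sub>E {- sqrt 3..sqrt 3}"

text \<open>The convex hull of \<open>d + 1\<close> points at equal positive mutual distances (such points
  are automatically affinely independent).\<close>

definition regular_simplex :: "nat \<Rightarrow> (nat \<Rightarrow> real) set \<Rightarrow> bool" where
  "regular_simplex d K \<longleftrightarrow>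
     (\<exists>v a. a > 0 \<and> (\<forall>k\<le>d. v k \<in> Rd d) \<and>
        (\<forall>k\<le>d. \<forall>l\<le>d. k \<noteq> l \<longrightarrow> L2_set (\<lambda>i. v k i - v l i) {..<d} = a) \<and>
        K = {(\<lambda>i\<in>{..<d}. \<Sum>k\<le>d. c k * v k i) | c.
               (\<forall>k\<le>d. c k \<ge> 0) \<and> (\<Sum>k\<le>d. c k) = 1})"

text \<open>For \<open>d \<ge> 1\<close>; coordinate \<open>0\<close> of \<open>x\<close> is \<open>s\<close> and the remaining ones form \<open>y\<close>.\<close>

definition convex_body_of_revolution :: "nat \<Rightarrow> (nat \<Rightarrow> real) set \<Rightarrow> bool" where
  "convex_body_of_revolution d K \<longleftrightarrow>
     convex_body d K \<and>
     (\<exists>I r. is_interval I \<and> concave_on I r \<and> (\<forall>s\<in>I. r s \<ge> 0) \<and>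
        K = {x \<in> Rd d. x 0 \<in> I \<and> L2_set x {1..<d} \<le> r (x 0)})"

end

theory Submission
  imports Defs
begin

text \<open>Write \<open>q = 1 / (2 * t)\<close>, so that the tilt multiplies the uniform measure by
  \<open>exp (- q * \<bar>x\<bar>\<^sup>2)\<close>. Two facts do most of the work. Tilting lowers the mean of
  \<open>\<bar>x\<bar>\<^sup>2\<close>, because the weight is a decreasing function of \<open>\<bar>x\<bar>\<^sup>2\<close>; for an isotropic body it
  is therefore at most \<open>d\<close> for every \<open>q\<close> (\<open>mean_ip_self_le\<close>). And a reflection in a hyperplane
  through the origin preserves both Lebesgue measure and the weight, so if it preserves the body, its
  normal is an eigenvector of the second-moment matrix (\<open>mean_reflect_orthogonal\<close>). In all three
  families the tilted covariance matrix is diagonal, and only its diagonal must be bounded.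

  For the cube the coordinate reflections suffice, as \<open>x\<^sub>i\<^sup>2 \<le> 3\<close> on the body. For the simplex the
  reflections that exchange two vertices make every edge direction an eigenvector; edges at a
  common vertex are not orthogonal, so they share their eigenvalue, and the covariance is a
  multiple \<open>\<lambda> * Id\<close> of the identity with \<open>d * \<lambda> \<le> d\<close>.

  For a body of revolution with \<open>n = d - 1 \<ge> 1\<close> the same argument gives
  \<open>n * E y\<^sub>i\<^sup>2 = E \<bar>y\<bar>\<^sup>2 \<le> n + 1\<close>, and it remains to bound the variance of the axial
  coordinate \<open>s\<close>. It has density proportional to \<open>F q s = exp (- q * s\<^sup>2) * G q (r s)\<close>, where
  \<open>G q \<rho>\<close> is the Gaussian mass of the \<open>n\<close>-ball of radius \<open>\<rho>\<close>. Everything rests on contracting the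
  axis by \<open>1/2\<close> towards a well-chosen centre \<open>c\<close>: a pointwise bound of the form
  \<open>p s * F q s \<le> C * F q' ((c + s) / 2)\<close> integrates, after a substitution, to a
  moment bound.

  \<^item> For \<open>q \<le> 1/256\<close> the tilted density is compared with the untilted one, \<open>F 0\<close>. The
    centre is the widest point \<open>s0\<close> of the body, \<open>R = r s0\<close>. Isotropy gives \<open>s0\<^sup>2 \<le> 7/2\<close>
    and \<open>R\<^sup>2 \<le> 64 * n\<close> (\<open>s0_sq_le\<close>, \<open>R_sq_le\<close>). The bound on \<open>R\<close> ensures that, up to radius
    \<open>R\<close>, the mass \<open>G q\<close> grows at least like \<open>\<rho> powr (n/2)\<close>, and always at most like
    \<open>\<rho> ^ n\<close>; hence \<open>F q\<close>, apart from its explicit factor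
    \<open>exp (- q * s\<^sup>2)\<close>, lies between multiples of \<open>F 0\<close> and of \<open>sqrt (F 0)\<close>
    (\<open>small_tilt\<close>).

  \<^item> For \<open>q \<ge> 1/256\<close> the density \<open>F q\<close> is strongly log-concave, because \<open>G q\<close> is
    log-concave and increasing and \<open>r\<close> is concave. Contracting towards a near-maximum of \<open>F q\<close>
    gives a variance of order \<open>1/q\<close> (\<open>large_tilt\<close>).\<close>

definition ip :: "nat \<Rightarrow> (nat \<Rightarrow> real) \<Rightarrow> (nat \<Rightarrow> real) \<Rightarrow> real" where
  "ip d x y = (\<Sum>i<d. x i * y i)"

lemma ip_commute: "ip d x y = ip d y x"
  by (simp add: ip_def mult.commute)

lemma measurable_ip [measurable]:
  "(\<lambda>x. ip d x w) \<in> borel_measurable (lborel_Rd d)"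
  unfolding ip_def by measurable

lemma measurable_ip_self [measurable]:
  "(\<lambda>x. ip d x x) \<in> borel_measurable (lborel_Rd d)"
  unfolding ip_def by measurable

lemma L2_set_sq_eq_ip: "(L2_set x {..<d})\<^sup>2 = ip d x x"
  by (simp add: L2_set_def ip_def power2_eq_square sum_nonneg)

section \<open>Reflections preserve the product Lebesgue measure\<close>

definition preserves :: "'a measure \<Rightarrow> ('a \<Rightarrow> 'a) \<Rightarrow> bool" where
  "preserves M T \<longleftrightarrow> T \<in> M \<rightarrow>\<^sub>M M \<and> distr M M T = M"

lemma preserves_comp:
  assumes "preserves M S" "preserves M T"
  shows "preserves M (S \<circ> T)"
proof -
  have "distr M M (S \<circ> T) = distr (distr M M T) M S"
    using assms by (intro distr_distr [symmetric]) (auto simp: preserves_def)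
  then show ?thesis
    using assms measurable_comp[of T M M S M] by (auto simp: preserves_def)
qed

lemma preserves_integral:
  fixes f :: "'a \<Rightarrow> real"
  assumes "preserves M T" "f \<in> borel_measurable M"
  shows "(LINT x|M. f (T x)) = (LINT x|M. f x)"
  using assms integral_distr[of T M M f] by (auto simp: preserves_def)

lemma preserves_cong:
  assumes "\<And>x. x \<in> space M \<Longrightarrow> S x = T x"
  shows "preserves M S \<longleftrightarrow> preserves M T"
  using assms measurable_cong[of M S T M] distr_cong[of M M M M S T] by (auto simp: preserves_def)

text \<open>The elementary building block: by Fubini one may integrate over coordinate \<open>p\<close> first, and there
  the map is a translation, possibly composed with a sign change.\<close>

lemma preserves_update:
  fixes c :: "(nat \<Rightarrow> real) \<Rightarrow> real" and \<sigma> :: real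
  assumes p: "p < d" and s: "\<bar>\<sigma>\<bar> = 1"
    and c [measurable]: "c \<in> borel_measurable (lborel_Rd d)"
    and cp: "\<And>x y. c (x(p := y)) = c x"
  shows "preserves (lborel_Rd d) (\<lambda>x. x(p := \<sigma> * x p + c x))" (is "preserves ?N ?T")
proof -
  interpret product_sigma_finite "\<lambda>_::nat. lborel :: real measure" by standard
  have I: "insert p ({..<d} - {p}) = {..<d}" using p by auto
  have [measurable]: "(\<lambda>x. x p) \<in> borel_measurable ?N"
    using p by (auto intro: measurable_component_singleton)
  have m: "?T \<in> ?N \<rightarrow>\<^sub>M ?N"
    by (rule measurable_fun_upd[where J="{..<d}"]) (use p in \<open>auto simp: insert_absorb\<close>)
  have "distr ?N ?N ?T = ?N"
  proof (rule measure_eqI)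
    fix A assume "A \<in> sets (distr ?N ?N ?T)"
    then have A: "A \<in> sets ?N" by simp
    then have A2: "A \<in> sets (Pi\<^sub>M (insert p ({..<d}-{p})) (\<lambda>_. lborel::real measure))"
      by (simp only: I)
    have s0: "\<sigma> \<noteq> 0" using s by auto
    let ?f = "\<lambda>x. indicator A x :: ennreal"
    have fm: "?f \<in> borel_measurable ?N" using A by simp
    have fTm: "(\<lambda>x. ?f (?T x)) \<in> borel_measurable ?N"
      using measurable_compose[OF m fm] by simp
    have "emeasure (distr ?N ?N ?T) A = (\<integral>\<^sup>+x. ?f (?T x) \<partial>?N)"
      using A m by (simp add: nn_integral_distr flip: nn_integral_indicator)
    also have "\<dots> = (\<integral>\<^sup>+x. (\<integral>\<^sup>+y. ?f (?T (x(p:=y))) \<partial>lborel) \<partial>Pi\<^sub>M ({..<d}-{p}) (\<lambda>_. lborel))"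
      using product_nn_integral_insert[of "{..<d}-{p}" p "\<lambda>x. ?f (?T x)"] fTm unfolding I by simp
    also have "\<dots> = (\<integral>\<^sup>+x. (\<integral>\<^sup>+y. ?f (x(p:=y)) \<partial>lborel) \<partial>Pi\<^sub>M ({..<d}-{p}) (\<lambda>_. lborel))"
    proof (rule nn_integral_cong)
      fix x assume x: "x \<in> space (Pi\<^sub>M ({..<d}-{p}) (\<lambda>_. lborel::real measure))"
      have upd: "(\<lambda>y. x(p:=y)) \<in> lborel \<rightarrow>\<^sub>M Pi\<^sub>M (insert p ({..<d}-{p})) (\<lambda>_. lborel::real measure)"
        by (rule measurable_fun_upd[where J="{..<d}-{p}"]) (use x in auto)
      have fm2: "?f \<in> borel_measurable (Pi\<^sub>M (insert p ({..<d}-{p})) (\<lambda>_. lborel::real measure))"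
        using A2 by simp
      have "(\<lambda>y. ?f (x(p:=y))) \<in> borel_measurable borel"
        using measurable_compose[OF upd fm2] by (simp cong: measurable_cong_sets)
      from nn_integral_real_affine[OF this s0, of "c x"]
      show "(\<integral>\<^sup>+y. ?f (?T (x(p:=y))) \<partial>lborel) = (\<integral>\<^sup>+y. ?f (x(p:=y)) \<partial>lborel)"
        using s by (simp add: cp add.commute)
    qed
    also have "\<dots> = (\<integral>\<^sup>+x. ?f x \<partial>?N)"
      using product_nn_integral_insert[of "{..<d}-{p}" p "\<lambda>x. ?f x"] fm unfolding I by simp
    finally show "emeasure (distr ?N ?N ?T) A = emeasure ?N A" using A by simp
  qed simp
  with m show ?thesis by (simp add: preserves_def)
qed

lemma preserves_shear:
  assumes p: "p < d" and J: "finite J" "J \<subseteq> {..<d} - {p}"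
  shows "preserves (lborel_Rd d) (\<lambda>x i. if i \<in> J then x i + a i * x p else x i)"
  using J
proof (induction J rule: finite_induct)
  case empty
  then show ?case by (simp add: preserves_def distr_id2 cong: measurable_cong_sets)
next
  case (insert j J)
  have "preserves (lborel_Rd d) (\<lambda>x. x(j := 1 * x j + a j * x p))"
    by (rule preserves_update) (use insert p in \<open>auto intro!: borel_measurable_times measurable_component_singleton\<close>)
  from preserves_comp[OF this insert.IH]
  have "preserves (lborel_Rd d)
     ((\<lambda>x. x(j := 1 * x j + a j * x p)) \<circ> (\<lambda>x i. if i \<in> J then x i + a i * x p else x i))"
    using insert by auto
  moreover have "((\<lambda>x. x(j := 1 * x j + a j * x p)) \<circ> (\<lambda>x i. if i \<in> J then x i + a i * x p else x i))
     = (\<lambda>x i. if i \<in> insert j J then x i + a i * x p else x i)"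
    using insert by (auto simp: fun_eq_iff)
  ultimately show ?case by simp
qed

text \<open>For a unit vector \<open>u\<close> this is the reflection in the affine hyperplane
  \<open>{x. ip d x u = b}\<close>. The restriction keeps its values extensional.\<close>

definition reflect :: "nat \<Rightarrow> (nat \<Rightarrow> real) \<Rightarrow> real \<Rightarrow> (nat \<Rightarrow> real) \<Rightarrow> nat \<Rightarrow> real" where
  "reflect d u b x = (\<lambda>i\<in>{..<d}. x i - 2 * (ip d x u - b) * u i)"

lemma ip_reflect: "ip d (reflect d u b x) w = ip d x w - 2 * (ip d x u - b) * ip d u w"
proof -
  have "ip d (reflect d u b x) w = (\<Sum>i<d. x i * w i - 2 * (ip d x u - b) * (u i * w i))"
    by (simp add: ip_def reflect_def algebra_simps)
  also have "\<dots> = ip d x w - 2 * (ip d x u - b) * ip d u w"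
    by (simp only: sum_subtractf sum_distrib_left [symmetric] ip_def)
  finally show ?thesis .
qed

lemma reflect_reflect:
  assumes "ip d u u = 1" "x \<in> Rd d"
  shows "reflect d u b (reflect d u b x) = x"
proof
  fix i
  have ipu: "ip d (reflect d u b x) u = 2 * b - ip d x u"
    using assms by (simp add: ip_reflect)
  have "reflect d u b (reflect d u b x) i = reflect d u b x i - 2 * (ip d (reflect d u b x) u - b) * u i"
    if "i < d" using that by (simp add: reflect_def)
  then have "reflect d u b (reflect d u b x) i = reflect d u b x i - 2 * (b - ip d x u) * u i"
    if "i < d" using that by (simp add: ipu)
  moreover have "x i = undefined" if "\<not> i < d" using assms(2) that by (auto simp: PiE_def extensional_def)
  ultimately show "reflect d u b (reflect d u b x) i = x i"
    by (cases "i < d") (simp_all add: reflect_def algebra_simps)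
qed

lemma ip_reflect_self:
  assumes "ip d u u = 1"
  shows "ip d (reflect d u 0 x) (reflect d u 0 x) = ip d x x"
proof -
  have "ip d (reflect d u 0 x) (reflect d u 0 x) = ip d x (reflect d u 0 x) - 2 * ip d x u * ip d u (reflect d u 0 x)"
    by (subst ip_reflect) simp
  also have "ip d x (reflect d u 0 x) = ip d x x - 2 * ip d x u * ip d u x"
    by (subst ip_commute, subst ip_reflect) simp
  also have "ip d u (reflect d u 0 x) = - ip d x u"
    using assms by (subst ip_commute, subst ip_reflect) simp
  finally show ?thesis by (simp add: ip_commute)
qed

text \<open>Choose \<open>p\<close> with \<open>u p \<noteq> 0\<close>. The shear \<open>S\<close> that fixes the other basis vectors and sends the
  \<open>p\<close>-th one to \<open>u / u p\<close> conjugates the reflection to a map that changes coordinate \<open>p\<close> only.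
  This avoids the change-of-variables formula for general orthogonal maps.\<close>

lemma preserves_reflect:
  assumes u: "ip d u u = 1"
  shows "preserves (lborel_Rd d) (reflect d u b)"
proof -
  have "\<exists>p<d. u p \<noteq> 0"
  proof (rule ccontr)
    assume "\<not> ?thesis"
    then have "ip d u u = 0" by (auto simp: ip_def)
    then show False using u by simp
  qed
  then obtain p where p: "p < d" "u p \<noteq> 0" by blast
  let ?J = "{..<d} - {p}"
  \<comment> \<open>\<open>S 1\<close> is the shear and \<open>S (-1)\<close> its inverse\<close>
  define S where "S = (\<lambda>\<sigma> x i. if i \<in> ?J then x i + (\<sigma> * u i / u p) * x p else x i :: real)"
  define c where "c = (\<lambda>x. 2 * b * u p - 2 * u p * (\<Sum>j\<in>?J. x j * u j))"
  define T where "T = (\<lambda>x. x(p := (-1) * x p + c x))"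
  have S: "preserves (lborel_Rd d) (S \<sigma>)" for \<sigma>
    unfolding S_def using p by (intro preserves_shear) auto
  have T: "preserves (lborel_Rd d) T"
    unfolding T_def
    by (rule preserves_update)
       (use p in \<open>auto simp: c_def intro!: borel_measurable_diff borel_measurable_times
          borel_measurable_sum measurable_component_singleton sum.cong\<close>)
  have uu: "(\<Sum>j\<in>?J. u j * u j) = 1 - u p * u p"
    using u p by (simp add: ip_def sum_diff1)
  have "preserves (lborel_Rd d) (S 1 \<circ> (T \<circ> S (-1)))"
    by (intro preserves_comp S T)
  moreover have "(S 1 \<circ> (T \<circ> S (-1))) x = reflect d u b x" if x: "x \<in> space (lborel_Rd d)" for x
  proof
    fix i
    have ipx: "ip d x u = (\<Sum>j\<in>?J. x j * u j) + x p * u p"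
      using p by (simp add: ip_def sum_diff1)
    have "(\<Sum>j\<in>?J. S (-1) x j * u j) = (\<Sum>j\<in>?J. x j * u j - (x p / u p) * (u j * u j))"
      by (intro sum.cong) (auto simp: S_def algebra_simps)
    also have "\<dots> = (\<Sum>j\<in>?J. x j * u j) - (x p / u p) * (1 - u p * u p)"
      by (simp only: sum_subtractf sum_distrib_left[symmetric] uu)
    also have "\<dots> = ip d x u - x p / u p"
      using p by (simp add: ipx field_simps)
    finally have s: "(\<Sum>j\<in>?J. S (-1) x j * u j) = ip d x u - x p / u p" .
    have Tp: "T (S (-1) x) p = x p - 2 * (ip d x u - b) * u p"
      using p(2) by (simp add: T_def c_def s) (simp add: S_def field_simps)
    have und: "x i = undefined" if "\<not> i < d"
      using x that by (auto simp: space_PiM PiE_def extensional_def)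
    consider "i = p" | "i \<noteq> p" "i < d" | "\<not> i < d" by blast
    then show "(S 1 \<circ> (T \<circ> S (-1))) x i = reflect d u b x i"
    proof cases
      case 1
      then have "(S 1 \<circ> (T \<circ> S (-1))) x i = T (S (-1) x) p" by (simp add: S_def)
      with 1 Tp p show ?thesis by (simp add: reflect_def)
    next
      case 2
      then have "(S 1 \<circ> (T \<circ> S (-1))) x i = S (-1) x i + u i / u p * T (S (-1) x) p"
        by (simp add: S_def T_def)
      also have "S (-1) x i = x i - u i / u p * x p" using 2 by (simp add: S_def)
      finally have "(S 1 \<circ> (T \<circ> S (-1))) x i =
          x i - u i / u p * x p + u i / u p * (x p - 2 * (ip d x u - b) * u p)"
        by (simp only: Tp)
      also have "\<dots> = x i - 2 * (ip d x u - b) * u i"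
        using p by (simp add: field_simps)
      finally show ?thesis using 2 by (simp add: reflect_def)
    next
      case 3
      then show ?thesis using p und by (auto simp: S_def T_def reflect_def)
    qed
  qed
  ultimately show ?thesis
    using preserves_cong[of "lborel_Rd d" "S 1 \<circ> (T \<circ> S (-1))" "reflect d u b"] by blast
qed

section \<open>Gaussian-weighted expectations over a bounded set\<close>

text \<open>The parameter \<open>q\<close> stands for \<open>1 / (2 * t)\<close>. Unlike \<open>t\<close>, it may be \<open>0\<close>, which gives the uniform
  distribution itself.\<close>

definition gauss_int :: "nat \<Rightarrow> (nat \<Rightarrow> real) set \<Rightarrow> real \<Rightarrow> ((nat \<Rightarrow> real) \<Rightarrow> real) \<Rightarrow> real" where
  "gauss_int d K q h = (LINT x|lborel_Rd d. indicator K x * exp (- q * ip d x x) * h x)"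

definition gauss_mean :: "nat \<Rightarrow> (nat \<Rightarrow> real) set \<Rightarrow> real \<Rightarrow> ((nat \<Rightarrow> real) \<Rightarrow> real) \<Rightarrow> real" where
  "gauss_mean d K q h = gauss_int d K q h / gauss_int d K q (\<lambda>_. 1)"

text \<open>A condition closed under the ring operations that guarantees integrability against every
  weight.\<close>

definition admissible :: "nat \<Rightarrow> (nat \<Rightarrow> real) set \<Rightarrow> ((nat \<Rightarrow> real) \<Rightarrow> real) \<Rightarrow> bool" where
  "admissible d K h \<longleftrightarrow> h \<in> borel_measurable (lborel_Rd d) \<and> (\<exists>C. \<forall>x\<in>K. \<bar>h x\<bar> \<le> C)"

lemma admissible_const: "admissible d K (\<lambda>_. c)"
  by (auto simp: admissible_def)

lemma admissible_add: "admissible d K g \<Longrightarrow> admissible d K h \<Longrightarrow> admissible d K (\<lambda>x. g x + h x)"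
  unfolding admissible_def
proof (elim conjE exE, intro conjI)
  fix A B assume "\<forall>x\<in>K. \<bar>g x\<bar> \<le> A" "\<forall>x\<in>K. \<bar>h x\<bar> \<le> B"
  then have "\<forall>x\<in>K. \<bar>g x + h x\<bar> \<le> A + B" by (meson abs_triangle_ineq add_mono order_trans)
  then show "\<exists>C. \<forall>x\<in>K. \<bar>g x + h x\<bar> \<le> C" by blast
qed auto

lemma admissible_mult: "admissible d K g \<Longrightarrow> admissible d K h \<Longrightarrow> admissible d K (\<lambda>x. g x * h x)"
  unfolding admissible_def
proof (elim conjE exE, intro conjI)
  fix A B assume "\<forall>x\<in>K. \<bar>g x\<bar> \<le> A" "\<forall>x\<in>K. \<bar>h x\<bar> \<le> B"
  then have "\<forall>x\<in>K. \<bar>g x * h x\<bar> \<le> \<bar>A\<bar> * \<bar>B\<bar>"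
    unfolding abs_mult by (intro ballI mult_mono) fastforce+
  then show "\<exists>C. \<forall>x\<in>K. \<bar>g x * h x\<bar> \<le> C" by blast
qed auto

lemma admissible_diff: "admissible d K g \<Longrightarrow> admissible d K h \<Longrightarrow> admissible d K (\<lambda>x. g x - h x)"
  using admissible_add[of d K g "\<lambda>x. (-1) * h x"] admissible_mult[of d K "\<lambda>_. -1" h] by (simp add: admissible_const)

lemma admissible_power: "admissible d K g \<Longrightarrow> admissible d K (\<lambda>x. g x ^ n)"
  by (induction n) (simp_all add: admissible_const admissible_mult)

lemma admissible_sum: "(\<And>i. i \<in> I \<Longrightarrow> admissible d K (g i)) \<Longrightarrow> admissible d K (\<lambda>x. \<Sum>i\<in>I. g i x)"
  by (induction I rule: infinite_finite_induct) (simp_all add: admissible_const admissible_add)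

locale solid =
  fixes d :: nat and K :: "(nat \<Rightarrow> real) set"
  assumes sets_K [measurable]: "K \<in> sets (lborel_Rd d)"
    and bounded_K: "\<exists>B. \<forall>x\<in>K. \<forall>i<d. \<bar>x i\<bar> \<le> B"
    and pos_K: "emeasure (lborel_Rd d) K \<noteq> 0"
begin

abbreviation N where "N \<equiv> lborel_Rd d"

lemma K_space: "x \<in> K \<Longrightarrow> x \<in> Rd d"
  using sets.sets_into_space[OF sets_K] by (auto simp: space_PiM)

lemma admissible_coord: "i < d \<Longrightarrow> admissible d K (\<lambda>x. x i)"
  using bounded_K by (auto simp: admissible_def intro!: measurable_component_singleton)

lemma admissible_ip: "admissible d K (\<lambda>x. ip d x w)"
  unfolding ip_def by (intro admissible_sum admissible_mult admissible_const admissible_coord) auto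

lemma admissible_ip_self: "admissible d K (\<lambda>x. ip d x x)"
  unfolding ip_def by (intro admissible_sum admissible_mult admissible_const admissible_coord) auto

lemma admissible_exp: "admissible d K g \<Longrightarrow> admissible d K (\<lambda>x. exp (g x))"
  unfolding admissible_def
proof (elim conjE exE, intro conjI)
  fix A assume "\<forall>x\<in>K. \<bar>g x\<bar> \<le> A"
  then have "\<forall>x\<in>K. \<bar>exp (g x)\<bar> \<le> exp A" by (auto simp: abs_le_iff)
  then show "\<exists>C. \<forall>x\<in>K. \<bar>exp (g x)\<bar> \<le> C" by blast
qed auto

lemmas admissible_intros = admissible_const admissible_add admissible_diff admissible_mult admissible_power admissible_sum admissible_coord admissible_ip admissible_ip_self

lemma finite_K: "emeasure N K < \<infinity>"
proof -
  interpret product_sigma_finite "\<lambda>_::nat. lborel :: real measure" by standard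
  obtain B where B: "\<forall>x\<in>K. \<forall>i<d. \<bar>x i\<bar> \<le> B" using bounded_K by blast
  have "K \<subseteq> {..<d} \<rightarrow>\<^sub>E {-B..B}"
  proof
    fix x assume x: "x \<in> K"
    then have "x \<in> extensional {..<d}" using K_space by (simp add: PiE_def)
    moreover have "x i \<in> {-B..B}" if "i < d" for i using B x that by (simp add: abs_le_iff) (smt (verit))
    ultimately show "x \<in> {..<d} \<rightarrow>\<^sub>E {-B..B}" by (auto simp: PiE_iff)
  qed
  then have "emeasure N K \<le> emeasure N ({..<d} \<rightarrow>\<^sub>E {-B..B})"
    by (intro emeasure_mono) (auto intro!: sets_PiM_I_finite)
  also have "\<dots> = (\<Prod>i<d. emeasure lborel {-B..B})"
    by (subst emeasure_PiM) auto
  also have "\<dots> < \<infinity>"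
    by (simp add: less_top[symmetric] power_eq_top_ennreal emeasure_lborel_Icc_eq)
  finally show ?thesis .
qed

lemma integrable_weighted:
  assumes "admissible d K h"
  shows "integrable N (\<lambda>x. indicator K x * h x)"
proof -
  obtain C where C: "\<forall>x\<in>K. \<bar>h x\<bar> \<le> C" using assms by (auto simp: admissible_def)
  have [measurable]: "h \<in> borel_measurable N" using assms by (auto simp: admissible_def)
  have "integrable N (\<lambda>x. indicator K x * C)"
    using finite_K by (intro integrable_mult_left integrable_real_indicator) auto
  then show ?thesis
    by (rule Bochner_Integration.integrable_bound) (use C in \<open>auto split: split_indicator intro!: AE_I2\<close>)
qed

lemma integrable_gauss_int:
  "admissible d K h \<Longrightarrow> integrable N (\<lambda>x. indicator K x * exp (- q * ip d x x) * h x)"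
  using integrable_weighted[of "\<lambda>x. exp (- q * ip d x x) * h x"]
    admissible_mult[OF admissible_exp[OF admissible_mult[OF admissible_const admissible_ip_self]], of h "-q"]
  by (simp add: mult.assoc)

lemma gauss_int_add: "admissible d K g \<Longrightarrow> admissible d K h \<Longrightarrow> gauss_int d K q (\<lambda>x. g x + h x) = gauss_int d K q g + gauss_int d K q h"
  unfolding gauss_int_def distrib_left by (intro Bochner_Integration.integral_add integrable_gauss_int)

lemma gauss_int_cmult: "gauss_int d K q (\<lambda>x. c * h x) = c * gauss_int d K q h"
  by (simp add: gauss_int_def mult.left_commute flip: integral_mult_right_zero)

lemma gauss_int_mono:
  assumes "admissible d K g" "admissible d K h" "\<And>x. x \<in> K \<Longrightarrow> g x \<le> h x"
  shows "gauss_int d K q g \<le> gauss_int d K q h"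
  unfolding gauss_int_def using assms
  by (intro integral_mono integrable_gauss_int) (auto split: split_indicator)

lemma gauss_int_cong:
  assumes "\<And>x. x \<in> K \<Longrightarrow> g x = h x"
  shows "gauss_int d K q g = gauss_int d K q h"
  unfolding gauss_int_def using assms
  by (intro Bochner_Integration.integral_cong) (auto split: split_indicator)

lemma vol_pos: "0 < measure N K"
  using pos_K finite_K by (simp add: measure_def enn2real_positive_iff less_top zero_less_iff_neq_zero)

lemma gauss_int_one_pos: "0 < gauss_int d K q (\<lambda>_. 1)"
proof -
  obtain C where C: "\<forall>x\<in>K. \<bar>- q * ip d x x\<bar> \<le> C"
    using admissible_mult[OF admissible_const admissible_ip_self, of "-q"] by (auto simp: admissible_def)
  have "0 < exp (- C) * measure N K" using vol_pos by simp
  also have "\<dots> = (LINT x|N. indicator K x * exp (- C))"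
    using finite_K by (simp add: mult.commute)
  also have "\<dots> \<le> gauss_int d K q (\<lambda>_. 1)"
    unfolding gauss_int_def
  proof (intro integral_mono integrable_gauss_int admissible_const)
    show "integrable N (\<lambda>x. indicator K x * exp (- C))"
      by (rule integrable_weighted) (rule admissible_const)
    fix x show "indicator K x * exp (- C) \<le> indicator K x * exp (- q * ip d x x) * 1"
      using C by (auto split: split_indicator simp: abs_le_iff)
  qed
  finally show ?thesis .
qed

lemma mean_const [simp]: "gauss_mean d K q (\<lambda>_. c) = c"
  using gauss_int_one_pos[of q] gauss_int_cmult[of q c "\<lambda>_. 1"] by (simp add: gauss_mean_def)

lemma mean_add: "admissible d K g \<Longrightarrow> admissible d K h \<Longrightarrow> gauss_mean d K q (\<lambda>x. g x + h x) = gauss_mean d K q g + gauss_mean d K q h"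
  by (simp add: gauss_mean_def gauss_int_add add_divide_distrib)

lemma mean_cmult: "gauss_mean d K q (\<lambda>x. c * h x) = c * gauss_mean d K q h"
  by (simp add: gauss_mean_def gauss_int_cmult)

lemma mean_diff: "admissible d K g \<Longrightarrow> admissible d K h \<Longrightarrow> gauss_mean d K q (\<lambda>x. g x - h x) = gauss_mean d K q g - gauss_mean d K q h"
  using mean_add[of g "\<lambda>x. (-1) * h x" q] admissible_mult[OF admissible_const, of d K h "-1"] mean_cmult[of q "-1" h] by simp

lemma mean_sum: "(\<And>i. i \<in> I \<Longrightarrow> admissible d K (g i)) \<Longrightarrow> gauss_mean d K q (\<lambda>x. \<Sum>i\<in>I. g i x) = (\<Sum>i\<in>I. gauss_mean d K q (g i))"
  by (induction I rule: infinite_finite_induct) (simp_all add: mean_add admissible_sum)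

lemma mean_mono:
  assumes "admissible d K g" "admissible d K h" "\<And>x. x \<in> K \<Longrightarrow> g x \<le> h x"
  shows "gauss_mean d K q g \<le> gauss_mean d K q h"
  unfolding gauss_mean_def using gauss_int_mono[OF assms] gauss_int_one_pos[of q] by (intro divide_right_mono) auto

lemma mean_cong: "(\<And>x. x \<in> K \<Longrightarrow> g x = h x) \<Longrightarrow> gauss_mean d K q g = gauss_mean d K q h"
  unfolding gauss_mean_def using gauss_int_cong by metis

lemma integral_uniform_on:
  assumes [measurable]: "h \<in> borel_measurable N"
  shows "(LINT x|uniform_on d K. h x) = gauss_mean d K 0 h"
proof -
  have "uniform_on d K = density N (\<lambda>x. ennreal (indicator K x / measure N K))"
    unfolding uniform_on_def uniform_measure_def
  proof (rule density_cong)
    have "emeasure N K = ennreal (measure N K)" using finite_K by (simp add: emeasure_eq_ennreal_measure)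
    then show "AE x in N. indicator K x / emeasure N K = ennreal (indicator K x / measure N K)"
      using vol_pos by (auto simp: divide_ennreal[symmetric] ennreal_indicator intro!: AE_I2)
  qed auto
  then have "(LINT x|uniform_on d K. h x) = (LINT x|N. indicator K x / measure N K * h x)"
    using vol_pos by (simp add: integral_density)
  also have "\<dots> = (LINT x|N. (indicator K x * h x) / measure N K)"
    by (intro Bochner_Integration.integral_cong) auto
  also have "\<dots> = (LINT x|N. indicator K x * h x) / measure N K" by simp
  finally show ?thesis
    using finite_K by (simp add: gauss_mean_def gauss_int_def)
qed

lemma integral_gauss_tilt:
  assumes [measurable]: "h \<in> borel_measurable N"
  shows "(LINT x|gauss_tilt d t (uniform_on d K). h x) = gauss_mean d K (1 / (2 * t)) h"
proof -
  let ?q = "1 / (2 * t)"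
  let ?e = "\<lambda>x. exp (- ?q * ip d x x)"
  define Z where "Z = (LINT y|uniform_on d K. ?e y)"
  have e: "- (L2_set x {..<d})\<^sup>2 / (2 * t) = - ?q * ip d x x" for x
    by (simp add: L2_set_sq_eq_ip)
  have w0: "gauss_int d K 0 (\<lambda>x. ?e x * h x) = gauss_int d K ?q h" for h
    by (simp add: gauss_int_def mult.assoc)
  have Z: "Z = gauss_int d K ?q (\<lambda>_. 1) / gauss_int d K 0 (\<lambda>_. 1)"
    using w0[of "\<lambda>_. 1"] by (simp add: Z_def integral_uniform_on gauss_mean_def)
  have Zpos: "0 < Z" using gauss_int_one_pos by (simp add: Z)
  have mu: "borel_measurable (uniform_on d K) = (borel_measurable N :: ((nat \<Rightarrow> real) \<Rightarrow> real) set)"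
    by (rule measurable_cong_sets) (simp_all add: uniform_on_def)
  have "(LINT x|gauss_tilt d t (uniform_on d K). h x) =
      (LINT x|uniform_on d K. ?e x / Z * h x)"
    unfolding gauss_tilt_def e Z_def[symmetric]
  proof (subst integral_density)
    show "h \<in> borel_measurable (uniform_on d K)" "(\<lambda>x. ?e x / Z) \<in> borel_measurable (uniform_on d K)"
      unfolding mu by measurable
  qed (use Zpos in auto)
  also have "\<dots> = gauss_mean d K 0 (\<lambda>x. 1 / Z * (?e x * h x))"
    by (subst integral_uniform_on) (auto intro: mean_cong)
  also have "\<dots> = 1 / Z * gauss_mean d K 0 (\<lambda>x. ?e x * h x)" by (rule mean_cmult)
  also have "\<dots> = gauss_mean d K ?q h"
    using gauss_int_one_pos[of 0] unfolding gauss_mean_def w0 Z by simp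
  finally show ?thesis .
qed

definition Cov :: "real \<Rightarrow> nat \<Rightarrow> nat \<Rightarrow> real" where
  "Cov q i j = gauss_mean d K q (\<lambda>x. x i * x j) - gauss_mean d K q (\<lambda>x. x i) * gauss_mean d K q (\<lambda>x. x j)"

lemma Cov_eq:
  assumes "i < d" "j < d"
  shows "gauss_mean d K q (\<lambda>x. (x i - gauss_mean d K q (\<lambda>x. x i)) * (x j - gauss_mean d K q (\<lambda>x. x j))) = Cov q i j"
proof -
  define a b where "a = gauss_mean d K q (\<lambda>x. x i)" and "b = gauss_mean d K q (\<lambda>x. x j)"
  have "gauss_mean d K q (\<lambda>x. (x i - a) * (x j - b)) = gauss_mean d K q (\<lambda>x. x i * x j - (b * x i + (a * x j - a * b)))"
    by (simp add: algebra_simps)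
  also have "\<dots> = gauss_mean d K q (\<lambda>x. x i * x j) - (b * gauss_mean d K q (\<lambda>x. x i) + (a * gauss_mean d K q (\<lambda>x. x j) - a * b))"
    using assms by (simp add: mean_diff mean_add mean_cmult admissible_intros)
  also have "\<dots> = Cov q i j" by (simp add: Cov_def a_def b_def)
  finally show ?thesis unfolding a_def b_def .
qed

lemma cov_gauss_tilt:
  assumes "i < d" "j < d"
  shows "cov (gauss_tilt d t (uniform_on d K)) i j = Cov (1 / (2 * t)) i j"
  using assms
  by (simp add: cov_def barycenter_def integral_gauss_tilt Cov_eq)

lemma barycenter_uniform: "i < d \<Longrightarrow> barycenter (uniform_on d K) i = gauss_mean d K 0 (\<lambda>x. x i)"
  by (simp add: barycenter_def integral_uniform_on)

lemma cov_uniform: "i < d \<Longrightarrow> j < d \<Longrightarrow> cov (uniform_on d K) i j = Cov 0 i j"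
  by (simp add: cov_def barycenter_def integral_uniform_on Cov_eq)

lemma Cov_self_nonneg: "i < d \<Longrightarrow> 0 \<le> Cov q i i"
  using mean_mono[of "\<lambda>_. 0" "\<lambda>x. (x i - gauss_mean d K q (\<lambda>x. x i)) * (x i - gauss_mean d K q (\<lambda>x. x i))" q]
  by (simp flip: Cov_eq add: admissible_mult admissible_diff admissible_coord admissible_const)

lemma Cov_self_le:
  assumes "i < d"
  shows "Cov q i i \<le> gauss_mean d K q (\<lambda>x. (x i - c)\<^sup>2)"
proof -
  define m where "m = gauss_mean d K q (\<lambda>x. x i)"
  have "gauss_mean d K q (\<lambda>x. (x i - c)\<^sup>2) = gauss_mean d K q (\<lambda>x. x i * x i - (2 * c * x i - c\<^sup>2))"
    by (simp add: power2_eq_square algebra_simps)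
  also have "\<dots> = gauss_mean d K q (\<lambda>x. x i * x i) - (2 * c * m - c\<^sup>2)"
    using assms by (simp add: mean_diff mean_cmult admissible_intros m_def)
  finally have "gauss_mean d K q (\<lambda>x. (x i - c)\<^sup>2) - Cov q i i = (m - c)\<^sup>2"
    by (simp add: Cov_def m_def power2_eq_square algebra_simps)
  then show ?thesis using zero_le_power2[of "m - c"] by linarith
qed

end

lemma op_norm_diag_le:
  assumes "\<And>i j. i < d \<Longrightarrow> j < d \<Longrightarrow> i \<noteq> j \<Longrightarrow> A i j = 0"
    and "\<And>i. i < d \<Longrightarrow> 0 \<le> A i i \<and> A i i \<le> c" and c: "0 \<le> c"
  shows "op_norm d A \<le> c"
  unfolding op_norm_def
proof (rule cSUP_least)
  have "(\<lambda>i\<in>{..<d}. 0) \<in> {v \<in> Rd d. L2_set v {..<d} \<le> 1}"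
    by (auto simp: L2_set_def)
  then show "{v \<in> Rd d. L2_set v {..<d} \<le> 1} \<noteq> {}" by blast
next
  fix v assume v: "v \<in> {v \<in> Rd d. L2_set v {..<d} \<le> 1}"
  have "L2_set (\<lambda>i. \<Sum>j<d. A i j * v j) {..<d} = L2_set (\<lambda>i. A i i * v i) {..<d}"
  proof (rule L2_set_cong)
    fix i assume i: "i \<in> {..<d}"
    then show "(\<Sum>j<d. A i j * v j) = A i i * v i"
      using assms(1) by (subst sum.remove[of _ i]) (auto intro!: sum.neutral)
  qed simp
  also have "\<dots> = L2_set (\<lambda>i. \<bar>A i i * v i\<bar>) {..<d}" by (simp add: L2_set_def)
  also have "\<dots> \<le> L2_set (\<lambda>i. c * \<bar>v i\<bar>) {..<d}"
    using assms(2) by (intro L2_set_mono) (auto simp: abs_mult intro!: mult_right_mono)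
  also have "\<dots> = c * L2_set v {..<d}"
    using c by (subst L2_set_right_distrib[symmetric]) (auto simp: L2_set_def)
  also have "\<dots> \<le> c" using v c by (simp add: mult_left_le)
  finally show "L2_set (\<lambda>i. \<Sum>j<d. A i j * v j) {..<d} \<le> c" .
qed

context solid
begin

lemma quadratic_tilt_stableI:
  assumes offdiag: "\<And>q i j. q > 0 \<Longrightarrow> i < d \<Longrightarrow> j < d \<Longrightarrow> i \<noteq> j \<Longrightarrow> Cov q i j = 0"
    and diag: "\<And>q i. q > 0 \<Longrightarrow> i < d \<Longrightarrow> Cov q i i \<le> c" and c: "0 \<le> c"
  shows "quadratic_tilt_stable d c (uniform_on d K)"
  unfolding quadratic_tilt_stable_def
proof (intro conjI allI impI)
  show "prob_space (uniform_on d K)"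
    unfolding uniform_on_def using pos_K finite_K by (intro prob_space_uniform_measure) auto
  show "sets (uniform_on d K) = sets N" by (simp add: uniform_on_def)
  fix t :: real assume t: "t > 0"
  show "op_norm d (cov (gauss_tilt d t (uniform_on d K))) \<le> c"
    using t c by (intro op_norm_diag_le) (auto simp: cov_gauss_tilt offdiag diag Cov_self_nonneg)
qed

text \<open>Chebyshev's correlation inequality: with \<open>c\<close> the untilted mean of \<open>\<bar>x\<bar>\<^sup>2\<close>, the factors
  \<open>\<bar>x\<bar>\<^sup>2 - c\<close> and \<open>exp (- q * \<bar>x\<bar>\<^sup>2) - exp (- q * c)\<close> have opposite signs.\<close>

lemma mean_ip_self_le:
  assumes "q \<ge> 0"
  shows "gauss_mean d K q (\<lambda>x. ip d x x) \<le> gauss_mean d K 0 (\<lambda>x. ip d x x)"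
proof -
  define c where "c = gauss_mean d K 0 (\<lambda>x. ip d x x)"
  have admissible: "admissible d K (\<lambda>x. ip d x x - c)" by (intro admissible_diff admissible_ip_self admissible_const)
  have "gauss_int d K q (\<lambda>x. ip d x x - c) = gauss_int d K 0 (\<lambda>x. exp (- q * ip d x x) * (ip d x x - c))"
    by (simp add: gauss_int_def mult.assoc)
  also have "\<dots> \<le> gauss_int d K 0 (\<lambda>x. exp (- q * c) * (ip d x x - c))"
  proof (rule gauss_int_mono)
    fix x
    show "exp (- q * ip d x x) * (ip d x x - c) \<le> exp (- q * c) * (ip d x x - c)"
    proof (cases "c \<le> ip d x x")
      case True
      then have "exp (- q * ip d x x) \<le> exp (- q * c)" using assms by (simp add: mult_left_mono)
      then show ?thesis using True by (intro mult_right_mono) auto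
    next
      case False
      then have "exp (- q * c) \<le> exp (- q * ip d x x)" using assms by (simp add: mult_left_mono)
      then show ?thesis using False by (intro mult_right_mono_neg) auto
    qed
  qed (intro admissible_mult admissible_exp admissible admissible_ip_self admissible_const)+
  also have "\<dots> = exp (- q * c) * (gauss_int d K 0 (\<lambda>_. 1) * gauss_mean d K 0 (\<lambda>x. ip d x x - c))"
    using gauss_int_one_pos[of 0] by (simp add: gauss_int_cmult gauss_mean_def)
  also have "gauss_mean d K 0 (\<lambda>x. ip d x x - c) = 0"
    by (subst mean_diff) (simp_all add: c_def admissible_intros)
  finally have "gauss_mean d K q (\<lambda>x. ip d x x - c) \<le> 0"
    using gauss_int_one_pos[of q] by (simp add: gauss_mean_def divide_le_0_iff)
  then show ?thesis by (subst (asm) mean_diff) (simp_all add: c_def admissible_intros)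
qed

text \<open>A reflection off the origin changes the Gaussian weight, so \<open>b \<noteq> 0\<close> is possible only for the
  uniform distribution. That case is what shows that the mirrors of an isotropic
  simplex pass through the origin.\<close>

lemma mean_reflect:
  assumes u: "ip d u u = 1" and b: "b = 0 \<or> q = 0"
    and inv: "\<And>x. x \<in> K \<Longrightarrow> reflect d u b x \<in> K"
    and h: "h \<in> borel_measurable N"
  shows "gauss_mean d K q (\<lambda>x. h (reflect d u b x)) = gauss_mean d K q h"
proof -
  have "gauss_int d K q h = (LINT x|N. indicator K (reflect d u b x) *
       exp (- q * ip d (reflect d u b x) (reflect d u b x)) * h (reflect d u b x))"
    unfolding gauss_int_def
    by (rule preserves_integral[OF preserves_reflect[OF u], symmetric]) (use h in measurable)
  also have "\<dots> = gauss_int d K q (\<lambda>x. h (reflect d u b x))"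
    unfolding gauss_int_def
  proof (rule Bochner_Integration.integral_cong)
    fix x assume x: "x \<in> space N"
    then have "reflect d u b (reflect d u b x) = x"
      using u by (intro reflect_reflect) (auto simp: space_PiM)
    then have "reflect d u b x \<in> K \<longleftrightarrow> x \<in> K" using inv by metis
    then show "indicator K (reflect d u b x) *
         exp (- q * ip d (reflect d u b x) (reflect d u b x)) * h (reflect d u b x) =
         indicator K x * exp (- q * ip d x x) * h (reflect d u b x)"
      using b ip_reflect_self[OF u, of x] by (auto split: split_indicator)
  qed simp
  finally show ?thesis by (simp add: gauss_mean_def)
qed

text \<open>The second part says that \<open>u\<close> is an eigenvector of the second-moment matrix: the component of \<open>w\<close>
  orthogonal to \<open>u\<close> is fixed by the reflection while \<open>ip d x u\<close> changes sign.\<close>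

lemma mean_reflect_orthogonal:
  assumes u: "ip d u u = 1" and inv: "\<And>x. x \<in> K \<Longrightarrow> reflect d u 0 x \<in> K"
  shows "gauss_mean d K q (\<lambda>x. ip d x u) = 0"
    and "gauss_mean d K q (\<lambda>x. ip d x w * ip d x u) = ip d w u * gauss_mean d K q (\<lambda>x. (ip d x u)\<^sup>2)"
proof -
  have "gauss_mean d K q (\<lambda>x. ip d x u) = gauss_mean d K q (\<lambda>x. ip d (reflect d u 0 x) u)"
    by (rule mean_reflect[symmetric]) (use assms in auto)
  also have "\<dots> = gauss_mean d K q (\<lambda>x. (-1) * ip d x u)"
    by (rule mean_cong) (simp add: ip_reflect u)
  finally show "gauss_mean d K q (\<lambda>x. ip d x u) = 0" by (simp only: mean_cmult)
  have "gauss_mean d K q (\<lambda>x. ip d x w * ip d x u) =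
      gauss_mean d K q (\<lambda>x. ip d (reflect d u 0 x) w * ip d (reflect d u 0 x) u)"
    by (rule mean_reflect[symmetric]) (use assms in auto)
  also have "\<dots> = gauss_mean d K q (\<lambda>x. 2 * ip d w u * (ip d x u)\<^sup>2 - ip d x w * ip d x u)"
    by (rule mean_cong) (simp add: ip_reflect u ip_commute[of d u w] power2_eq_square algebra_simps)
  also have "\<dots> = 2 * ip d w u * gauss_mean d K q (\<lambda>x. (ip d x u)\<^sup>2) - gauss_mean d K q (\<lambda>x. ip d x w * ip d x u)"
    by (subst mean_diff) (simp_all add: mean_cmult admissible_intros)
  finally show "gauss_mean d K q (\<lambda>x. ip d x w * ip d x u) = ip d w u * gauss_mean d K q (\<lambda>x. (ip d x u)\<^sup>2)"
    by simp
qed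

end

section \<open>Compact sets of extensional functions\<close>

lemma compact_continuous_real_image:
  assumes "compactin (powertop_real {..<d}) K" "continuous_map (powertop_real {..<d}) euclideanreal f"
  shows "compact (f ` K)"
  using image_compactin[OF assms] by simp

lemma compactin_bounded:
  fixes d :: nat
  assumes "compactin (powertop_real {..<d}) K"
  shows "\<exists>B. \<forall>x\<in>K. \<forall>i<d. \<bar>x i\<bar> \<le> B"
proof -
  have "\<exists>B. \<forall>x\<in>K. \<bar>x i\<bar> \<le> B" if "i < d" for i
  proof -
    have "compact ((\<lambda>x. x i) ` K)"
      using that by (intro compact_continuous_real_image[OF assms] continuous_map_product_projection) auto
    from compact_imp_bounded[OF this] show ?thesis by (auto simp: bounded_iff)
  qed
  then obtain B where B: "\<And>i x. i < d \<Longrightarrow> x \<in> K \<Longrightarrow> \<bar>x i\<bar> \<le> B i" by metis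
  have "\<bar>x i\<bar> \<le> (\<Sum>i<d. \<bar>B i\<bar>)" if "x \<in> K" "i < d" for x i
  proof -
    have "\<bar>x i\<bar> \<le> \<bar>B i\<bar>" using B[OF that(2,1)] by linarith
    also have "\<dots> \<le> (\<Sum>i<d. \<bar>B i\<bar>)" using that by (intro member_le_sum[where f = "\<lambda>i. \<bar>B i\<bar>"]) auto
    finally show ?thesis .
  qed
  then show ?thesis by blast
qed

text \<open>Extending by \<open>0\<close> beyond \<open>d\<close> carries the question to the full product
  \<open>nat \<Rightarrow> real\<close>, where the Borel sets are known to be those of the product \<open>\<sigma>\<close>-algebra.\<close>

lemma compactin_sets:
  assumes "compactin (powertop_real {..<d}) K"
  shows "K \<in> sets (lborel_Rd d)"
proof -
  have KR: "K \<subseteq> Rd d" using compactin_subset_topspace[OF assms] by (simp add: PiE_def)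
  have "closedin (powertop_real {..<d}) K"
    using assms by (intro compactin_imp_closedin) (auto simp: Hausdorff_space_product_topology)
  moreover have "continuous_map euclidean (powertop_real {..<d}) (\<lambda>x::nat\<Rightarrow>real. restrict x {..<d})"
    by (auto simp: continuous_map_componentwise continuous_map_iff_continuous2 restrict_def extensional_def
          intro!: continuous_on_product_coordinates)
  ultimately have "closedin euclidean {x \<in> topspace euclidean. (restrict x {..<d} :: nat \<Rightarrow> real) \<in> K}"
    by (rule closedin_continuous_map_preimage[rotated])
  then have cl: "closed {x::nat\<Rightarrow>real. restrict x {..<d} \<in> K}" by simp
  let ?e = "\<lambda>(x::nat\<Rightarrow>real) i. if i < d then x i else 0"
  have "?e \<in> lborel_Rd d \<rightarrow>\<^sub>M Pi\<^sub>M UNIV (\<lambda>_. borel)"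
  proof (rule measurable_PiM_single')
    fix i :: nat
    show "(\<lambda>x. ?e x i) \<in> lborel_Rd d \<rightarrow>\<^sub>M borel"
      by (cases "i < d") (auto intro!: measurable_component_singleton)
  qed auto
  then have e: "?e \<in> lborel_Rd d \<rightarrow>\<^sub>M borel"
    by (simp add: measurable_cong_sets[OF refl sets_PiM_equal_borel])
  have "?e -` {x. restrict x {..<d} \<in> K} \<inter> space (lborel_Rd d) \<in> sets (lborel_Rd d)"
    using cl by (intro measurable_sets[OF e]) auto
  also have "?e -` {x. restrict x {..<d} \<in> K} \<inter> space (lborel_Rd d) = K"
  proof -
    have "restrict (?e x) {..<d} = x" if "x \<in> Rd d" for x
      using that by (auto simp: fun_eq_iff PiE_def extensional_def)
    then show ?thesis using KR by (auto simp: space_PiM)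
  qed
  finally show ?thesis .
qed

text \<open>A null set would have the zero measure as its uniform distribution, and hence covariance
  \<open>0\<close>; so positive volume follows from isotropy.\<close>

lemma solid_isotropic:
  assumes "isotropic_body d K" "d \<ge> 1"
  shows "solid d K"
proof
  have c: "compactin (powertop_real {..<d}) K" using assms by (auto simp: isotropic_body_def convex_body_def)
  show K: "K \<in> sets (lborel_Rd d)" by (rule compactin_sets[OF c])
  show "\<exists>B. \<forall>x\<in>K. \<forall>i<d. \<bar>x i\<bar> \<le> B" by (rule compactin_bounded[OF c])
  show "emeasure (lborel_Rd d) K \<noteq> 0"
  proof
    assume "emeasure (lborel_Rd d) K = 0"
    then have "AE x in lborel_Rd d. x \<notin> K"
      using K by (intro AE_not_in) (auto simp: null_sets_def)
    then have "emeasure (uniform_on d K) (space (uniform_on d K)) = 0"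
      unfolding uniform_on_def uniform_measure_def
      using K by (subst emeasure_density) (auto simp: nn_integral_0_iff_AE elim!: eventually_mono)
    then have "AE x in uniform_on d K. False"
      by (subst AE_iff_null) (auto simp: null_sets_def)
    then have "cov (uniform_on d K) 0 0 = 0"
      unfolding cov_def by (intro integral_eq_zero_AE) (auto elim: eventually_mono)
    moreover have "cov (uniform_on d K) 0 0 = 1"
      using assms by (auto simp: isotropic_body_def)
    ultimately show False by simp
  qed
qed

section \<open>The cube\<close>

definition unitv :: "nat \<Rightarrow> nat \<Rightarrow> real" where
  "unitv i j = (if j = i then 1 else 0)"

lemma ip_unitv: "i < d \<Longrightarrow> ip d x (unitv i) = x i"
  by (simp add: ip_def unitv_def if_distrib cong: if_cong)

lemma reflect_unitv:
  "i < d \<Longrightarrow> reflect d (unitv i) 0 x = (\<lambda>j\<in>{..<d}. if j = i then - x j else x j)"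
  by (auto simp: reflect_def ip_unitv unitv_def fun_eq_iff)

context solid
begin

lemma mean_multc: "gauss_mean d K q (\<lambda>x. h x * c) = gauss_mean d K q h * c"
  using mean_cmult[of q c h] by (simp add: mult.commute)

lemma Cov_flip:
  assumes i: "i < d" and inv: "\<And>x. x \<in> K \<Longrightarrow> reflect d (unitv i) 0 x \<in> K"
  shows "Cov q i i = gauss_mean d K q (\<lambda>x. (x i)\<^sup>2)"
    and "j < d \<Longrightarrow> j \<noteq> i \<Longrightarrow> Cov q i j = 0 \<and> Cov q j i = 0"
proof -
  have u: "ip d (unitv i) (unitv i) = 1" using i by (simp add: ip_unitv) (simp add: unitv_def)
  have 0: "gauss_mean d K q (\<lambda>x. x i) = 0"
    using mean_reflect_orthogonal(1)[OF u inv] i by (simp add: ip_unitv)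
  then show "Cov q i i = gauss_mean d K q (\<lambda>x. (x i)\<^sup>2)"
    by (simp add: Cov_def power2_eq_square)
  assume j: "j < d" "j \<noteq> i"
  have "gauss_mean d K q (\<lambda>x. x j * x i) = 0"
    using mean_reflect_orthogonal(2)[OF u inv, of q "unitv j"] i j
    by (simp add: ip_unitv) (simp add: unitv_def)
  then show "Cov q i j = 0 \<and> Cov q j i = 0"
    using 0 by (simp add: Cov_def mult.commute)
qed

end

lemma solid_cube: "solid d (isotropic_cube d)"
proof
  interpret product_sigma_finite "\<lambda>_::nat. lborel :: real measure" by standard
  show "isotropic_cube d \<in> sets (lborel_Rd d)"
    unfolding isotropic_cube_def by (intro sets_PiM_I_finite) auto
  show "\<exists>B. \<forall>x\<in>isotropic_cube d. \<forall>i<d. \<bar>x i\<bar> \<le> B"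
    by (intro exI[of _ "sqrt 3"]) (fastforce simp: isotropic_cube_def abs_le_iff PiE_iff minus_le_iff)
  show "emeasure (lborel_Rd d) (isotropic_cube d) \<noteq> 0"
    unfolding isotropic_cube_def
    by (subst emeasure_PiM) (auto simp: emeasure_lborel_Icc_eq)
qed

lemma cube_stable: "quadratic_tilt_stable d 3 (uniform_on d (isotropic_cube d))"
proof -
  interpret solid d "isotropic_cube d" by (rule solid_cube)
  have inv: "reflect d (unitv i) 0 x \<in> isotropic_cube d" if "x \<in> isotropic_cube d" "i < d" for x i
    using that by (auto simp: reflect_unitv isotropic_cube_def PiE_iff minus_le_iff)
  show ?thesis
  proof (rule quadratic_tilt_stableI)
    fix q i j assume "i < d" "j < d" "i \<noteq> j"
    then show "Cov q i j = 0" using Cov_flip(2)[OF _ inv, of i] by auto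
  next
    fix q i assume i: "i < d"
    have sq: "x i * x i \<le> 3" if "x \<in> isotropic_cube d" for x
    proof -
      have "\<bar>x i\<bar> \<le> sqrt 3" using that i by (auto simp: isotropic_cube_def PiE_iff abs_le_iff minus_le_iff)
      then have "(x i)\<^sup>2 \<le> 3" using power_mono[of "\<bar>x i\<bar>" "sqrt 3" 2] by simp
      then show ?thesis by (simp add: power2_eq_square)
    qed
    have "Cov q i i = gauss_mean d (isotropic_cube d) q (\<lambda>x. (x i)\<^sup>2)"
      by (rule Cov_flip(1)) (use i inv in auto)
    also have "\<dots> \<le> gauss_mean d (isotropic_cube d) q (\<lambda>_. 3)"
      using i sq by (intro mean_mono) (auto simp: admissible_intros power2_eq_square)
    finally show "Cov q i i \<le> 3" by simp
  qed simp
qed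

section \<open>The simplex\<close>

lemma ip_diff_left: "ip d (\<lambda>i. x i - y i) z = ip d x z - ip d y z"
  by (simp add: ip_def left_diff_distrib sum_subtractf)

lemma ip_scale_left: "ip d (\<lambda>i. c * x i) z = c * ip d x z"
  by (simp add: ip_def sum_distrib_left mult.assoc)

lemma ip_scale_right: "ip d z (\<lambda>i. c * x i) = c * ip d z x"
  by (simp add: ip_def sum_distrib_left mult_ac)

lemma ip_diff_right: "ip d z (\<lambda>i. x i - y i) = ip d z x - ip d z y"
  by (simp add: ip_def right_diff_distrib sum_subtractf)

lemma ip_restrict_sum: "ip d (\<lambda>i\<in>{..<d}. \<Sum>k\<in>A. c k * v k i) w = (\<Sum>k\<in>A. c k * ip d (v k) w)"
proof -
  have "ip d (\<lambda>i\<in>{..<d}. \<Sum>k\<in>A. c k * v k i) w = (\<Sum>i<d. \<Sum>k\<in>A. c k * (v k i * w i))"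
    by (simp add: ip_def sum_distrib_right mult.assoc)
  also have "\<dots> = (\<Sum>k\<in>A. \<Sum>i<d. c k * (v k i * w i))" by (rule sum.swap)
  finally show ?thesis by (simp add: ip_def sum_distrib_left)
qed

lemma ip_self_eq_0:
  assumes "ip d z z = 0" "i < d"
  shows "z i = 0"
  using assms by (simp add: ip_def sum_nonneg_eq_0_iff)

context solid
begin

lemma isotropic_moments:
  assumes "isotropic_body d K"
  shows "gauss_mean d K 0 (\<lambda>x. ip d x w) = 0"
    and "gauss_mean d K 0 (\<lambda>x. (ip d x w)\<^sup>2) = ip d w w"
    and "gauss_mean d K 0 (\<lambda>x. ip d x x) = d"
proof -
  have m: "gauss_mean d K 0 (\<lambda>x. x i) = 0" if "i < d" for i
    using assms that barycenter_uniform by (auto simp: isotropic_body_def)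
  have c: "gauss_mean d K 0 (\<lambda>x. x i * x j) = (if i = j then 1 else 0)" if "i < d" "j < d" for i j
    using assms that cov_uniform[of i j] m[of i] by (auto simp: isotropic_body_def Cov_def)
  have "gauss_mean d K 0 (\<lambda>x. ip d x w) = (\<Sum>i<d. gauss_mean d K 0 (\<lambda>x. w i * x i))"
    unfolding ip_def by (subst mean_sum) (auto simp: admissible_intros mult.commute)
  then show "gauss_mean d K 0 (\<lambda>x. ip d x w) = 0" by (simp add: mean_cmult m)
  have "gauss_mean d K 0 (\<lambda>x. (ip d x w)\<^sup>2) = gauss_mean d K 0 (\<lambda>x. \<Sum>i<d. \<Sum>j<d. (w i * w j) * (x i * x j))"
    by (simp add: ip_def power2_eq_square sum_product mult_ac)
  also have "\<dots> = (\<Sum>i<d. \<Sum>j<d. (w i * w j) * gauss_mean d K 0 (\<lambda>x. x i * x j))"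
  proof -
    have "gauss_mean d K 0 (\<lambda>x. \<Sum>j<d. (w i * w j) * (x i * x j)) = (\<Sum>j<d. (w i * w j) * gauss_mean d K 0 (\<lambda>x. x i * x j))"
      if "i < d" for i
      using that by (subst mean_sum) (auto simp: mean_cmult intro!: admissible_intros)
    then show ?thesis by (subst mean_sum) (auto intro!: admissible_intros)
  qed
  also have "\<dots> = (\<Sum>i<d. \<Sum>j<d. if i = j then w i * w j else 0)"
    by (intro sum.cong refl) (simp add: c)
  also have "\<dots> = ip d w w" by (simp add: ip_def)
  finally show "gauss_mean d K 0 (\<lambda>x. (ip d x w)\<^sup>2) = ip d w w" .
  have "gauss_mean d K 0 (\<lambda>x. ip d x x) = (\<Sum>i<d. gauss_mean d K 0 (\<lambda>x. x i * x i))"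
    unfolding ip_def by (subst mean_sum) (auto simp: admissible_intros)
  then show "gauss_mean d K 0 (\<lambda>x. ip d x x) = d" by (simp add: c)
qed

end

text \<open>The perpendicular bisector of an edge contains all other vertices, because these are equidistant
  from its ends. So the reflection permutes the vertices, and being affine it permutes the
  barycentric coordinates.\<close>

lemma simplex_reflect:
  assumes v: "\<And>k. k \<le> d \<Longrightarrow> v k \<in> Rd d" and a: "a > 0"
    and dist: "\<And>k l. k \<le> d \<Longrightarrow> l \<le> d \<Longrightarrow> k \<noteq> l \<Longrightarrow> L2_set (\<lambda>i. v k i - v l i) {..<d} = a"
    and K: "K = {(\<lambda>i\<in>{..<d}. \<Sum>k\<le>d. c k * v k i) | c. (\<forall>k\<le>d. c k \<ge> 0) \<and> (\<Sum>k\<le>d. c k) = 1}"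
    and k: "0 < k" "k \<le> d"
    and u: "u = (\<lambda>i. 1 / a * (v k i - v 0 i))"
    and b: "b = (ip d (v k) u + ip d (v 0) u) / 2"
    and x: "x \<in> K"
  shows "reflect d u b x \<in> K"
proof -
  have sq: "ip d (v m) (v m) - 2 * ip d (v m) (v l) + ip d (v l) (v l) = a\<^sup>2"
    if "m \<le> d" "l \<le> d" "m \<noteq> l" for m l
    using L2_set_sq_eq_ip[of "\<lambda>i. v m i - v l i" d] dist[OF that]
    by (simp add: ip_diff_left ip_diff_right ip_commute[of d "v l" "v m"])
  have ipu: "ip d y u = 1 / a * (ip d y (v k) - ip d y (v 0))" for y
    unfolding u by (simp only: ip_scale_right ip_diff_right)
  have side: "ip d (v m) u = b" if "m \<le> d" "m \<noteq> 0" "m \<noteq> k" for m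
  proof -
    have "ip d (v m) (v k) - ip d (v m) (v 0) =
        ((ip d (v k) (v k) - ip d (v k) (v 0)) + (ip d (v 0) (v k) - ip d (v 0) (v 0))) / 2"
      using sq[of m 0] sq[of m k] that k by (simp add: ip_commute[of d "v 0" "v k"])
    then show ?thesis
      unfolding b ipu distrib_left [symmetric] by (simp only: times_divide_eq_right)
  qed
  have ends: "ip d (v k) u - b = a / 2" "ip d (v 0) u - b = - a / 2"
  proof -
    have "ip d (v k) u - b = 1 / a * ((ip d (v k) (v k) - 2 * ip d (v k) (v 0) + ip d (v 0) (v 0)) / 2)"
         "ip d (v 0) u - b = - (1 / a * ((ip d (v k) (v k) - 2 * ip d (v k) (v 0) + ip d (v 0) (v 0)) / 2))"
      unfolding b ipu ip_commute[of d "v 0" "v k"] by (simp_all add: algebra_simps add_divide_distrib diff_divide_distrib)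
    then show "ip d (v k) u - b = a / 2" "ip d (v 0) u - b = - a / 2"
      using sq[of k 0] k a by (simp_all add: power2_eq_square)
  qed
  obtain c where c: "\<forall>k\<le>d. c k \<ge> 0" "(\<Sum>k\<le>d. c k) = 1" and xc: "x = (\<lambda>i\<in>{..<d}. \<Sum>k\<le>d. c k * v k i)"
    using x unfolding K by blast
  define \<tau> where "\<tau> = Transposition.transpose k (0::nat)"
  have bij: "bij_betw \<tau> {..d} {..d}"
    unfolding \<tau>_def using k by (intro bij_betw_transpose_iff) auto
  have \<tau>le: "\<tau> j \<le> d" if "j \<le> d" for j using bij that by (auto simp: bij_betw_def)
  have \<tau>\<tau>: "\<tau> (\<tau> j) = j" for j by (simp add: \<tau>_def)
  have vr: "v j i - 2 * (ip d (v j) u - b) * u i = v (\<tau> j) i" if "j \<le> d" for i j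
  proof -
    consider "j = 0" | "j = k" | "j \<noteq> 0" "j \<noteq> k" by blast
    then show ?thesis
    proof cases
      case 1
      then show ?thesis using ends a by (simp add: u \<tau>_def)
    next
      case 2
      have "v k i - 2 * (ip d (v k) u - b) * u i = v 0 i"
        unfolding ends(1) using a by (simp add: u)
      then show ?thesis using 2 by (simp add: \<tau>_def)
    next
      case 3
      then show ?thesis using side[OF that] by (simp add: \<tau>_def)
    qed
  qed
  have "reflect d u b x = (\<lambda>i\<in>{..<d}. \<Sum>k\<le>d. c (\<tau> k) * v k i)"
  proof
    fix i
    show "reflect d u b x i = (\<lambda>i\<in>{..<d}. \<Sum>k\<le>d. c (\<tau> k) * v k i) i"
    proof (cases "i < d")
      case True
      have "ip d x u - b = (\<Sum>j\<le>d. c j * ip d (v j) u) - b * (\<Sum>j\<le>d. c j)"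
        unfolding xc ip_restrict_sum using c by simp
      also have "\<dots> = (\<Sum>j\<le>d. c j * (ip d (v j) u - b))"
        by (simp add: right_diff_distrib sum_subtractf sum_distrib_left mult.commute)
      finally have "x i - 2 * (ip d x u - b) * u i = (\<Sum>j\<le>d. c j * v j i) - 2 * (\<Sum>j\<le>d. c j * (ip d (v j) u - b)) * u i"
        using True by (simp add: xc)
      also have "\<dots> = (\<Sum>j\<le>d. c j * (v j i - 2 * (ip d (v j) u - b) * u i))"
        by (simp add: right_diff_distrib sum_subtractf sum_distrib_left sum_distrib_right mult_ac)
      also have "\<dots> = (\<Sum>j\<le>d. c j * v (\<tau> j) i)"
        by (intro sum.cong refl arg_cong2[where f = "(*)"] vr) simp
      also have "\<dots> = (\<Sum>j\<le>d. c (\<tau> j) * v j i)"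
        by (subst sum.reindex_bij_betw[OF bij, symmetric]) (simp add: \<tau>\<tau>)
      finally show ?thesis using True by (simp add: reflect_def)
    qed (simp add: reflect_def)
  qed
  moreover have "(\<Sum>j\<le>d. c (\<tau> j)) = 1" using c sum.reindex_bij_betw[OF bij, of c] by simp
  moreover have "\<forall>j\<le>d. c (\<tau> j) \<ge> 0" using c \<tau>le by simp
  ultimately show ?thesis unfolding K by (intro CollectI exI[of _ "\<lambda>j. c (\<tau> j)"] conjI)
qed

lemma simplex_stable:
  assumes d: "d \<ge> 1" and simplex: "regular_simplex d K" and iso: "isotropic_body d K"
  shows "quadratic_tilt_stable d 1 (uniform_on d K)"
proof -
  interpret solid d K by (rule solid_isotropic[OF iso d])
  obtain v a where a: "a > 0" and v: "\<And>k. k \<le> d \<Longrightarrow> v k \<in> Rd d"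
    and dist: "\<And>k l. k \<le> d \<Longrightarrow> l \<le> d \<Longrightarrow> k \<noteq> l \<Longrightarrow> L2_set (\<lambda>i. v k i - v l i) {..<d} = a"
    and K: "K = {(\<lambda>i\<in>{..<d}. \<Sum>k\<le>d. c k * v k i) | c. (\<forall>k\<le>d. c k \<ge> 0) \<and> (\<Sum>k\<le>d. c k) = 1}"
    using simplex unfolding regular_simplex_def by blast
  define u where "u = (\<lambda>k i. 1 / a * (v k i - v 0 i))"
  have sq: "ip d (v m) (v m) - 2 * ip d (v m) (v l) + ip d (v l) (v l) = a\<^sup>2"
    if "m \<le> d" "l \<le> d" "m \<noteq> l" for m l
    using L2_set_sq_eq_ip[of "\<lambda>i. v m i - v l i" d] dist[OF that]
    by (simp add: ip_diff_left ip_diff_right ip_commute[of d "v l" "v m"])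
  have ipu: "ip d y (u k) = 1 / a * (ip d y (v k) - ip d y (v 0))" for y k
    unfolding u_def by (simp only: ip_scale_right ip_diff_right)
  have ipuu: "ip d (u l) (u k) =
      1 / a * (1 / a * (ip d (v l) (v k) - ip d (v 0) (v k) - (ip d (v l) (v 0) - ip d (v 0) (v 0))))" for k l
  proof -
    have "ip d (u l) y = 1 / a * (ip d (v l) y - ip d (v 0) y)" for y
      unfolding u_def by (simp only: ip_scale_left ip_diff_left)
    then show ?thesis by (simp add: ipu right_diff_distrib)
  qed
  have unit: "ip d (u k) (u k) = 1" if "0 < k" "k \<le> d" for k
    using sq[of k 0] that a unfolding ipuu
    by (simp add: field_simps power2_eq_square ip_commute[of d "v 0" "v k"])
  have half: "ip d (u k) (u l) = 1 / 2" if "0 < k" "k \<le> d" "0 < l" "l \<le> d" "k \<noteq> l" for k l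
    using sq[of k 0] sq[of l 0] sq[of k l] that a unfolding ipuu
    by (simp add: field_simps power2_eq_square ip_commute[of d "v 0" "v l"])
  define b where "b = (\<lambda>k. (ip d (v k) (u k) + ip d (v 0) (u k)) / 2)"
  have inv: "reflect d (u k) (b k) x \<in> K" if "0 < k" "k \<le> d" "x \<in> K" for k x
    by (rule simplex_reflect[where k = k and v = v and a = a])
       (use that v a dist in \<open>simp_all add: b_def u_def K\<close>)
  \<comment> \<open>the barycenter is fixed by the reflection, so the mirror contains the origin\<close>
  have b0: "b k = 0" if k: "0 < k" "k \<le> d" for k
  proof -
    have "0 = gauss_mean d K 0 (\<lambda>x. ip d (reflect d (u k) (b k) x) (u k))"
      using mean_reflect[of "u k" "b k" 0 "\<lambda>x. ip d x (u k)"] unit[OF k] inv[OF k]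
      by (simp add: isotropic_moments[OF iso])
    also have "\<dots> = gauss_mean d K 0 (\<lambda>x. 2 * b k - ip d x (u k))"
      by (rule mean_cong) (simp add: ip_reflect unit[OF k])
    also have "\<dots> = 2 * b k"
      by (simp add: mean_diff admissible_intros isotropic_moments[OF iso])
    finally show ?thesis by simp
  qed
  \<comment> \<open>a vector orthogonal to all edges at vertex 0 is constant on the body, so isotropy forces it to vanish\<close>
  have orth0: "z i = 0" if z: "\<And>k. 0 < k \<Longrightarrow> k \<le> d \<Longrightarrow> ip d z (u k) = 0" and i: "i < d" for z i
  proof -
    have eq: "ip d (v k) z = ip d (v 0) z" if "k \<le> d" for k
      using z[of k] that a by (cases "k = 0") (auto simp: ipu ip_commute[of d z])
    have "ip d x z = ip d (v 0) z" if "x \<in> K" for x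
    proof -
      obtain c where c: "(\<Sum>k\<le>d. c k) = 1" and xc: "x = (\<lambda>i\<in>{..<d}. \<Sum>k\<le>d. c k * v k i)"
        using \<open>x \<in> K\<close> unfolding K by blast
      have "ip d x z = (\<Sum>k\<le>d. c k * ip d (v 0) z)"
        unfolding xc ip_restrict_sum
        by (intro sum.cong refl arg_cong2[where f = "(*)"] eq) simp
      then show ?thesis using c by (simp flip: sum_distrib_right)
    qed
    then have const: "gauss_mean d K 0 (\<lambda>x. h (ip d x z)) = h (ip d (v 0) z)" for h
      using mean_cong[of "\<lambda>x. h (ip d x z)" "\<lambda>_. h (ip d (v 0) z)" 0] by simp
    have "ip d z z = 0"
      using const[of "\<lambda>y. y"] const[of "\<lambda>y. y\<^sup>2"] isotropic_moments(1,2)[OF iso, of z] by simp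
    then show ?thesis using i by (rule ip_self_eq_0)
  qed
  have mean: "gauss_mean d K q (\<lambda>x. x i) = 0" if "i < d" for q i
  proof (rule orth0[OF _ that])
    fix k assume k: "0 < k" "k \<le> d"
    have "ip d (\<lambda>i. gauss_mean d K q (\<lambda>x. x i)) (u k) = gauss_mean d K q (\<lambda>x. ip d x (u k))"
      unfolding ip_def by (subst mean_sum) (simp_all add: admissible_intros mean_multc)
    also have "\<dots> = 0"
      using unit[OF k] inv[OF k] b0[OF k] by (intro mean_reflect_orthogonal) auto
    finally show "ip d (\<lambda>i. gauss_mean d K q (\<lambda>x. x i)) (u k) = 0" .
  qed
  define lam where "lam = (\<lambda>q. gauss_mean d K q (\<lambda>x. (ip d x (u 1))\<^sup>2))"
  have eig: "gauss_mean d K q (\<lambda>x. ip d x w * ip d x (u k)) = ip d w (u k) * gauss_mean d K q (\<lambda>x. (ip d x (u k))\<^sup>2)"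
    if k: "0 < k" "k \<le> d" for q k w
    using unit[OF k] inv[OF k] b0[OF k] by (intro mean_reflect_orthogonal) auto
  \<comment> \<open>\<open>E <x,u k><x,u 1>\<close> evaluates to the inner product 1/2 times either of the two eigenvalues\<close>
  have same: "gauss_mean d K q (\<lambda>x. (ip d x (u k))\<^sup>2) = lam q" if k: "0 < k" "k \<le> d" for q k
  proof (cases "k = 1")
    case False
    have "gauss_mean d K q (\<lambda>x. ip d x (u k) * ip d x (u 1)) = gauss_mean d K q (\<lambda>x. ip d x (u 1) * ip d x (u k))"
      by (simp add: mult.commute)
    moreover have h: "ip d (u k) (u 1) = 1 / 2" "ip d (u 1) (u k) = 1 / 2"
      using half[of k 1] half[of 1 k] k False d by auto
    ultimately show ?thesis
      using eig[of 1 q "u k", unfolded h] eig[of k q "u 1", unfolded h] k d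
      unfolding lam_def by linarith
  qed (simp add: lam_def)
  have second: "gauss_mean d K q (\<lambda>x. x i * x j) = lam q * unitv i j" if i: "i < d" and j: "j < d" for q i j
  proof -
    have "(\<lambda>j. gauss_mean d K q (\<lambda>x. x i * x j) - lam q * unitv i j) j = 0"
    proof (rule orth0[OF _ j])
      fix k assume k: "0 < k" "k \<le> d"
      have "ip d (\<lambda>j. gauss_mean d K q (\<lambda>x. x i * x j)) (u k) = (\<Sum>j<d. gauss_mean d K q (\<lambda>x. x i * x j * u k j))"
        by (simp only: ip_def mean_multc)
      also have "\<dots> = gauss_mean d K q (\<lambda>x. x i * ip d x (u k))"
        unfolding ip_def sum_distrib_left using i
        by (subst mean_sum) (simp_all add: admissible_intros mult.assoc)
      also have "\<dots> = u k i * lam q"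
        using eig[OF k, of q "unitv i"] i same[OF k] by (simp add: ip_unitv ip_commute[of d "unitv i"])
      finally show "ip d (\<lambda>j. gauss_mean d K q (\<lambda>x. x i * x j) - lam q * unitv i j) (u k) = 0"
        using i by (simp add: ip_diff_left ip_scale_left ip_commute[of d "unitv i"] ip_unitv mult.commute)
    qed
    then show ?thesis by simp
  qed
  have le1: "lam q \<le> 1" if "q > 0" for q
  proof -
    have "real d * lam q = (\<Sum>i<d. gauss_mean d K q (\<lambda>x. x i * x i))"
      by (simp add: second unitv_def)
    also have "\<dots> = gauss_mean d K q (\<lambda>x. ip d x x)"
      unfolding ip_def by (subst mean_sum) (auto simp: admissible_intros)
    also have "\<dots> \<le> d"
      using mean_ip_self_le[of q] that isotropic_moments(3)[OF iso] by simp
    finally show ?thesis using d by (simp add: mult_le_cancel_left1)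
  qed
  show ?thesis
    by (rule quadratic_tilt_stableI) (simp_all add: Cov_def mean second le1, simp_all add: unitv_def le1)
qed

section \<open>The Gaussian mass of balls\<close>

text \<open>The model is \<open>G \<rho> = \<integral> exp (- q * \<bar>y\<bar>\<^sup>2)\<close> over the \<open>n\<close>-ball of radius \<open>\<rho>\<close>, with \<open>\<omega>\<close>
  the volume of the unit ball. The assumptions bound the mass of an annulus by its volume times
  the extreme values of the weight. They determine the derivative of \<open>G\<close>, which replaces
  integration in polar coordinates.\<close>

locale radial =
  fixes n :: nat and \<omega> q :: real and G :: "real \<Rightarrow> real"
  assumes n_pos: "n \<ge> 1" and \<omega>_pos: "\<omega> > 0" and q_nonneg: "q \<ge> 0" and G_0: "G 0 = 0"
    and step_lower: "\<And>a b. 0 \<le> a \<Longrightarrow> a \<le> b \<Longrightarrow> \<omega> * (b ^ n - a ^ n) * exp (- q * b\<^sup>2) \<le> G b - G a"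
    and step_upper: "\<And>a b. 0 \<le> a \<Longrightarrow> a \<le> b \<Longrightarrow> G b - G a \<le> \<omega> * (b ^ n - a ^ n) * exp (- q * a\<^sup>2)"
begin

text \<open>\<open>w\<close> is the derivative of \<open>G\<close>, and \<open>X x = x * w x\<close>. The logarithmic derivative of \<open>G\<close> with
  respect to \<open>ln x\<close> is \<open>X / G\<close>, so bounds on \<open>X / G\<close> are growth bounds for \<open>G\<close>; they all follow
  by differentiating once more.\<close>

definition w :: "real \<Rightarrow> real" where "w x = \<omega> * real n * x ^ (n - 1) * exp (- q * x\<^sup>2)"

definition X :: "real \<Rightarrow> real" where "X x = \<omega> * real n * x ^ n * exp (- q * x\<^sup>2)"

lemma X_eq: "X x = x * w x"
  using n_pos power_eq_if[of x n] by (simp add: X_def w_def mult_ac)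

lemma w_nonneg: "x \<ge> 0 \<Longrightarrow> w x \<ge> 0"
  using \<omega>_pos by (simp add: w_def)

lemma G_mono: "0 \<le> a \<Longrightarrow> a \<le> b \<Longrightarrow> G a \<le> G b"
proof -
  assume ab: "0 \<le> a" "a \<le> b"
  then have "0 \<le> \<omega> * (b ^ n - a ^ n) * exp (- q * b\<^sup>2)"
    using \<omega>_pos power_mono[of a b n] by simp
  with step_lower[OF ab] show ?thesis by linarith
qed

lemma G_pos: "x > 0 \<Longrightarrow> G x > 0"
proof -
  assume x: "x > 0"
  then have "0 < \<omega> * (x ^ n - 0 ^ n) * exp (- q * x\<^sup>2)"
    using \<omega>_pos n_pos by (simp add: zero_power)
  then show ?thesis using step_lower[of 0 x] x G_0 by simp
qed

lemma G_nonneg: "x \<ge> 0 \<Longrightarrow> G x \<ge> 0"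
  using G_mono[of 0 x] G_0 by simp

lemma step_error:
  assumes "a \<ge> 0" "b \<ge> 0"
  shows "\<bar>G b - G a - \<omega> * (b ^ n - a ^ n) * exp (- q * a\<^sup>2)\<bar>
           \<le> \<bar>\<omega> * (b ^ n - a ^ n) * (exp (- q * b\<^sup>2) - exp (- q * a\<^sup>2))\<bar>"
proof (cases "a \<le> b")
  case True
  then show ?thesis
    using step_lower[of a b] step_upper[of a b] assms by (simp add: algebra_simps)
next
  case False
  then show ?thesis
    using step_lower[of b a] step_upper[of b a] assms by (simp add: algebra_simps)
qed

text \<open>The error of the linearisation is bounded by the product \<open>Q\<close> of two increments, whose derivative
  at \<open>x\<close> is \<open>0\<close>.\<close>

lemma G_has_derivative:
  assumes x: "x > 0"
  shows "(G has_real_derivative w x) (at x)"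
proof -
  define P where "P = (\<lambda>y. \<omega> * (y ^ n - x ^ n) * exp (- q * x\<^sup>2))"
  define Q where "Q = (\<lambda>y. \<omega> * (y ^ n - x ^ n) * (exp (- q * y\<^sup>2) - exp (- q * x\<^sup>2)))"
  have P: "(P has_real_derivative w x) (at x)"
    unfolding P_def w_def by (auto intro!: derivative_eq_intros simp: mult_ac)
  have "(Q has_real_derivative 0) (at x)"
    unfolding Q_def by (auto intro!: derivative_eq_intros)
  then have Q: "((\<lambda>y. Q y / (y - x)) \<longlongrightarrow> 0) (at x)"
    by (simp add: has_field_derivative_iff Q_def)
  have "((\<lambda>y. (G y - G x) / (y - x) - P y / (y - x)) \<longlongrightarrow> 0) (at x)"
  proof (rule Lim_null_comparison)
    have "\<forall>\<^sub>F y in at x. y > 0" using x by (intro order_tendstoD(1)[OF tendsto_ident_at]) 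
    then show "\<forall>\<^sub>F y in at x. norm ((G y - G x) / (y - x) - P y / (y - x)) \<le> \<bar>Q y / (y - x)\<bar>"
    proof eventually_elim
      case (elim y)
      have "\<bar>G y - G x - P y\<bar> \<le> \<bar>Q y\<bar>"
        using step_error[of x y] x elim unfolding P_def Q_def by simp
      then show ?case
        by (simp add: diff_divide_distrib[symmetric] abs_divide divide_right_mono)
    qed
    show "((\<lambda>y. \<bar>Q y / (y - x)\<bar>) \<longlongrightarrow> 0) (at x)" using tendsto_rabs_zero[OF Q] .
  qed
  moreover have "((\<lambda>y. P y / (y - x)) \<longlongrightarrow> w x) (at x)"
    using P by (simp add: has_field_derivative_iff P_def)
  ultimately have "((\<lambda>y. ((G y - G x) / (y - x) - P y / (y - x)) + P y / (y - x)) \<longlongrightarrow> 0 + w x) (at x)"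
    by (rule tendsto_add)
  then show ?thesis by (simp add: has_field_derivative_iff)
qed

lemma X_has_derivative: "(X has_real_derivative (real n - 2 * q * x\<^sup>2) * w x) (at x)"
proof -
  have "x ^ n = x * x ^ (n - 1)" using n_pos power_eq_if[of x n] by simp
  then show ?thesis
    unfolding X_def w_def
    by (auto intro!: derivative_eq_intros simp: algebra_simps power2_eq_square)
qed

lemma G_continuous: "continuous_on {0..} G"
proof (rule continuous_on_eq_continuous_within[THEN iffD2], rule ballI)
  fix x :: real assume "x \<in> {0..}"
  show "continuous (at x within {0..}) G"
  proof (cases "x = 0")
    case True
    have "(G \<longlongrightarrow> 0) (at 0 within {0..})"
    proof (rule tendsto_sandwich)
      show "\<forall>\<^sub>F x in at 0 within {0..}. 0 \<le> G x"
        by (auto simp: eventually_at_filter G_nonneg)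
      show "\<forall>\<^sub>F x in at 0 within {0..}. G x \<le> \<omega> * x ^ n"
        using step_upper[of 0] G_0 n_pos by (auto simp: eventually_at_filter zero_power)
      have "((\<lambda>x. \<omega> * x ^ n) \<longlongrightarrow> \<omega> * 0 ^ n) (at 0 within {0..})" by (intro tendsto_intros)
      then show "((\<lambda>x. \<omega> * x ^ n) \<longlongrightarrow> 0) (at 0 within {0..})" using n_pos by (simp add: zero_power)
    qed simp
    then show ?thesis using True G_0 by (simp add: continuous_within)
  next
    case False
    then have "isCont G x" using \<open>x \<in> {0..}\<close> by (intro DERIV_isCont[OF G_has_derivative]) auto
    then show ?thesis by (rule continuous_at_imp_continuous_at_within)
  qed
qed

lemma nonneg_of_nonneg_derivative:
  fixes F :: "real \<Rightarrow> real"
  assumes "x \<ge> 0" "F 0 = 0" "continuous_on {0..} F"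
    and "\<And>y. 0 < y \<Longrightarrow> y < x \<Longrightarrow> (F has_real_derivative F' y) (at y)"
    and "\<And>y. 0 < y \<Longrightarrow> y < x \<Longrightarrow> F' y \<ge> 0"
  shows "F x \<ge> 0"
proof -
  have "F 0 \<le> F x"
  proof (rule DERIV_nonneg_imp_increasing_open[where f = F])
    show "continuous_on {0..x} F" using assms(3) by (rule continuous_on_subset) auto
  qed (use assms in auto)
  then show ?thesis using assms(2) by simp
qed

lemma X_continuous: "continuous_on {0..} X"
  unfolding X_def by (intro continuous_intros)

lemma X_0: "X 0 = 0"
  by (simp add: X_eq)

lemma X_le: "x \<ge> 0 \<Longrightarrow> X x \<le> real n * G x"
proof -
  assume x: "x \<ge> 0"
  have "0 \<le> real n * G x - X x"
  proof (rule nonneg_of_nonneg_derivative[OF x, where F = "\<lambda>x. real n * G x - X x" and F' = "\<lambda>x. 2 * q * x\<^sup>2 * w x"])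
    show "((\<lambda>x. real n * G x - X x) has_real_derivative 2 * q * y\<^sup>2 * w y) (at y)" if "0 < y" for y
      using that by (auto intro!: derivative_eq_intros G_has_derivative X_has_derivative simp: algebra_simps)
  qed (auto simp: G_0 X_0 w_nonneg q_nonneg intro!: continuous_intros G_continuous X_continuous)
  then show ?thesis by simp
qed

text \<open>The radius at which \<open>4 * q * x\<^sup>2 = n\<close> is where the derivative of \<open>X - n / 2 * G\<close> changes sign.\<close>

lemma X_ge: "x \<ge> 0 \<Longrightarrow> 4 * q * x\<^sup>2 \<le> n \<Longrightarrow> real n / 2 * G x \<le> X x"
proof -
  assume x: "x \<ge> 0" and q: "4 * q * x\<^sup>2 \<le> n"
  have "0 \<le> X x - real n / 2 * G x"
  proof (rule nonneg_of_nonneg_derivative[OF x, where F = "\<lambda>x. X x - real n / 2 * G x" and F' = "\<lambda>x. (real n / 2 - 2 * q * x\<^sup>2) * w x"])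
    show "((\<lambda>x. X x - real n / 2 * G x) has_real_derivative (real n / 2 - 2 * q * y\<^sup>2) * w y) (at y)" if "0 < y" for y
      using that by (auto intro!: derivative_eq_intros G_has_derivative X_has_derivative simp: algebra_simps)
    fix y assume y: "0 < y" "y < x"
    then have "4 * q * y\<^sup>2 \<le> 4 * q * x\<^sup>2" using q_nonneg by (intro mult_left_mono power_mono) auto
    then show "0 \<le> (real n / 2 - 2 * q * y\<^sup>2) * w y" using q y by (intro mult_nonneg_nonneg w_nonneg) auto
  qed (auto simp: G_0 X_0 intro!: continuous_intros G_continuous X_continuous)
  then show ?thesis by simp
qed

text \<open>Since \<open>x * w' = (n - 1 - 2 * q * x\<^sup>2) * w\<close>, this is \<open>w' * G \<le> w\<^sup>2\<close>, the log-concavity of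
  \<open>G\<close>, freed of denominators.\<close>

lemma X_ge_curvature: "x \<ge> 0 \<Longrightarrow> (real n - 1 - 2 * q * x\<^sup>2) * G x \<le> X x"
proof -
  assume x: "x \<ge> 0"
  have "0 \<le> X x - (real n - 1 - 2 * q * x\<^sup>2) * G x"
  proof (rule nonneg_of_nonneg_derivative[OF x, where F = "\<lambda>x. X x - (real n - 1 - 2 * q * x\<^sup>2) * G x"
        and F' = "\<lambda>x. w x + 4 * q * x * G x"])
    show "((\<lambda>x. X x - (real n - 1 - 2 * q * x\<^sup>2) * G x) has_real_derivative w y + 4 * q * y * G y) (at y)" if "0 < y" for y
      using that by (auto intro!: derivative_eq_intros G_has_derivative X_has_derivative simp: algebra_simps)
  qed (auto simp: G_0 X_0 w_nonneg G_nonneg q_nonneg intro!: continuous_intros G_continuous X_continuous)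
  then show ?thesis by simp
qed

lemma ln_G_derivative:
  assumes "x > 0"
  shows "((\<lambda>x. ln (G x)) has_real_derivative w x / G x) (at x)"
  using assms G_pos[OF assms]
  by (auto intro!: derivative_eq_intros G_has_derivative)

lemma ln_G_minus_derivative:
  assumes "x > 0"
  shows "((\<lambda>x. ln (G x) - c * ln x) has_real_derivative (X x - c * G x) / (x * G x)) (at x)"
proof -
  have "(X x - c * G x) / (x * G x) = w x / G x - c * (1 / x)"
    using assms G_pos[OF assms] by (simp add: X_eq field_simps)
  moreover have "((\<lambda>x. ln (G x) - c * ln x) has_real_derivative w x / G x - c * (1 / x)) (at x)"
    using assms by (intro DERIV_diff ln_G_derivative DERIV_cmult DERIV_ln_divide)
  ultimately show ?thesis by simp
qed

text \<open>The mass grows at most like the volume.\<close>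

lemma G_ratio_le:
  assumes "0 \<le> x" "x \<le> y"
  shows "G y * x ^ n \<le> G x * y ^ n"
proof (cases "x = 0")
  case True
  then show ?thesis using G_0 n_pos by (simp add: zero_power)
next
  case False
  then have x: "x > 0" and y: "y > 0" using assms by auto
  have "ln (G y) - n * ln y \<le> ln (G x) - n * ln x"
  proof (rule DERIV_nonpos_imp_nonincreasing[OF assms(2)])
    fix z assume z: "x \<le> z" "z \<le> y"
    then have "(X z - n * G z) / (z * G z) \<le> 0"
      using X_le[of z] G_pos[of z] x by (intro divide_nonpos_pos) auto
    then show "\<exists>D. ((\<lambda>z. ln (G z) - n * ln z) has_real_derivative D) (at z) \<and> D \<le> 0"
      using ln_G_minus_derivative[of z] z x by fastforce
  qed
  then have "ln (G y * x ^ n) \<le> ln (G x * y ^ n)"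
    using x y G_pos[OF x] G_pos[OF y] by (simp add: ln_mult ln_realpow)
  then show ?thesis using x y G_pos[OF x] G_pos[OF y] by simp
qed

text \<open>As long as the Gaussian factor is not too small, the mass grows at least like the square root of
  the volume; squaring avoids fractional powers.\<close>

lemma G_ratio_sq_le:
  assumes "0 \<le> x" "x \<le> y" "4 * q * y\<^sup>2 \<le> n"
  shows "(G x)\<^sup>2 * y ^ n \<le> (G y)\<^sup>2 * x ^ n"
proof (cases "x = 0")
  case True
  then show ?thesis using G_0 n_pos by (simp add: zero_power)
next
  case False
  then have x: "x > 0" and y: "y > 0" using assms by auto
  have "ln (G x) - real n / 2 * ln x \<le> ln (G y) - real n / 2 * ln y"
  proof (rule DERIV_nonneg_imp_nondecreasing[OF assms(2)])
    fix z assume z: "x \<le> z" "z \<le> y"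
    have "4 * q * z\<^sup>2 \<le> 4 * q * y\<^sup>2" using q_nonneg z x by (intro mult_left_mono power_mono) auto
    then have "0 \<le> (X z - real n / 2 * G z) / (z * G z)"
      using X_ge[of z] G_pos[of z] x z assms(3) by (intro divide_nonneg_pos) auto
    then show "\<exists>D. ((\<lambda>z. ln (G z) - real n / 2 * ln z) has_real_derivative D) (at z) \<and> 0 \<le> D"
      using ln_G_minus_derivative[of z "real n / 2"] z x by fastforce
  qed
  then have "ln ((G x)\<^sup>2 * y ^ n) \<le> ln ((G y)\<^sup>2 * x ^ n)"
    using x y G_pos[OF x] G_pos[OF y] by (simp add: ln_mult ln_realpow algebra_simps)
  then show ?thesis using x y G_pos[OF x] G_pos[OF y] by simp
qed

lemma w_ratio_derivative:
  assumes x: "x > 0"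
  shows "((\<lambda>x. w x / G x) has_real_derivative
     w x * ((real n - 1 - 2 * q * x\<^sup>2) * G x - X x) / (x * (G x)\<^sup>2)) (at x)"
proof -
  have 1: "((\<lambda>x. X x / (x * G x)) has_real_derivative
      ((real n - 2 * q * x\<^sup>2) * w x * (x * G x) - X x * (G x + x * w x)) / (x * G x)\<^sup>2) (at x)"
    using x G_pos[OF x]
    by (auto intro!: derivative_eq_intros X_has_derivative G_has_derivative simp: power2_eq_square mult_ac)
  have 2: "((real n - 2 * q * x\<^sup>2) * w x * (x * G x) - X x * (G x + x * w x)) / (x * G x)\<^sup>2 =
     w x * ((real n - 1 - 2 * q * x\<^sup>2) * G x - X x) / (x * (G x)\<^sup>2)"
    using x G_pos[OF x] by (simp add: X_eq divide_simps) (simp add: algebra_simps power2_eq_square)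
  have "\<forall>\<^sub>F y in nhds x. y \<in> {0<..}" using x by (intro eventually_nhds_in_open) auto
  then have 3: "\<forall>\<^sub>F y in nhds x. X y / (y * G y) = w y / G y"
    by eventually_elim (simp add: X_eq)
  show ?thesis
    using DERIV_cong_ev[OF refl 3 2] 1 by blast
qed

lemma G_log_concave:
  assumes "a \<ge> 0" "b \<ge> 0"
  shows "G a * G b \<le> (G ((a + b) / 2))\<^sup>2"
proof (cases "a = 0 \<or> b = 0")
  case True
  then show ?thesis using G_0 by auto
next
  case False
  then have ab: "a > 0" "b > 0" using assms by auto
  have "concave_on {0<..} (\<lambda>x. ln (G x))"
  proof (rule f''_le0_imp_concave)
    fix x :: real assume x: "x \<in> {0<..}"
    then show "((\<lambda>x. ln (G x)) has_real_derivative w x / G x) (at x)"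
      by (intro ln_G_derivative) auto
    show "((\<lambda>x. w x / G x) has_real_derivative
       w x * ((real n - 1 - 2 * q * x\<^sup>2) * G x - X x) / (x * (G x)\<^sup>2)) (at x)"
      using x by (intro w_ratio_derivative) auto
    show "w x * ((real n - 1 - 2 * q * x\<^sup>2) * G x - X x) / (x * (G x)\<^sup>2) \<le> 0"
      using x X_ge_curvature[of x] w_nonneg[of x]
      by (intro divide_nonpos_nonneg mult_nonneg_nonpos) auto
  qed auto
  then have "(1 - 1/2) * ln (G a) + 1/2 * ln (G b) \<le> ln (G ((1 - 1/2) *\<^sub>R a + (1/2) *\<^sub>R b))"
    using ab by (intro concave_onD) auto
  then have *: "ln (G a) + ln (G b) \<le> 2 * ln (G ((a + b) / 2))"
    by (simp add: field_simps)
  have m: "G ((a + b) / 2) > 0" using ab by (intro G_pos) auto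
  have "ln (G a * G b) \<le> ln ((G ((a + b) / 2))\<^sup>2)"
    using * ab G_pos[of a] G_pos[of b] m by (simp add: ln_mult ln_realpow)
  then show ?thesis using G_pos[OF ab(1)] G_pos[OF ab(2)] m by simp
qed

end

definition ball_mass :: "nat set \<Rightarrow> (real \<Rightarrow> real) \<Rightarrow> real \<Rightarrow> real" where
  "ball_mass J k \<rho> =
     (LINT y|Pi\<^sub>M J (\<lambda>_. lborel). indicator {y. L2_set y J \<le> \<rho>} y * k (L2_set y J))"

lemma measurable_L2_set [measurable]:
  "J \<subseteq> I \<Longrightarrow> (\<lambda>y. L2_set y J) \<in> borel_measurable (Pi\<^sub>M I (\<lambda>_. lborel::real measure))"
  unfolding L2_set_def
  by (intro measurable_compose[OF _ borel_measurable_sqrt] borel_measurable_sum borel_measurable_power)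
    (auto intro: measurable_component_singleton)

lemma emeasure_L2_ball:
  assumes J: "finite J" "card J = n" "n \<ge> 1" and \<rho>: "\<rho> \<ge> 0"
  shows "emeasure (Pi\<^sub>M J (\<lambda>_. lborel)) {y \<in> space (Pi\<^sub>M J (\<lambda>_. lborel)). L2_set y J \<le> \<rho>} =
     ennreal (unit_ball_vol (real n) * \<rho> ^ n)" (is "emeasure ?M (?B \<rho>) = _")
proof -
  have pos: "emeasure ?M (?B \<rho>) = ennreal (unit_ball_vol (real n) * \<rho> ^ n)" if "\<rho> > 0" for \<rho>
  proof -
    have "?B \<rho> = {f. sqrt (\<Sum>i\<in>J. (f i)\<^sup>2) \<le> \<rho>} \<inter> space ?M" by (auto simp: L2_set_def)
    then show ?thesis using emeasure_cball_aux[OF J(1) that] J(2) by simp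
  qed
  show ?thesis
  proof (cases "\<rho> = 0")
    case False
    then show ?thesis using pos \<rho> by simp
  next
    case True
    have "((\<lambda>\<rho>. ennreal (unit_ball_vol (real n) * \<rho> ^ n)) \<longlongrightarrow> ennreal (unit_ball_vol (real n) * 0 ^ n)) (at_right 0)"
      by (intro tendsto_ennrealI tendsto_intros)
    then have lim: "((\<lambda>\<rho>. ennreal (unit_ball_vol (real n) * \<rho> ^ n)) \<longlongrightarrow> 0) (at_right 0)"
      using J(3) by (simp add: zero_power)
    have "\<forall>\<^sub>F \<epsilon> in at_right (0::real). emeasure ?M (?B 0) \<le> ennreal (unit_ball_vol (real n) * \<epsilon> ^ n)"
      unfolding eventually_at_filter
    proof (intro always_eventually allI impI)
      fix \<epsilon> :: real assume "\<epsilon> \<noteq> 0" "\<epsilon> \<in> {0<..}"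
      then show "emeasure ?M (?B 0) \<le> ennreal (unit_ball_vol (real n) * \<epsilon> ^ n)"
        by (subst pos[symmetric]) (auto intro!: emeasure_mono)
    qed
    then have "emeasure ?M (?B 0) \<le> 0"
      by (intro tendsto_lowerbound[OF lim]) auto
    then show ?thesis using True J(3) by (simp add: zero_power)
  qed
qed

text \<open>The two weights of interest are the Gaussian and \<open>\<rho>\<^sup>2\<close>; the growth bound is one that both
  satisfy.\<close>

locale radial_weight =
  fixes J :: "nat set" and n :: nat and k :: "real \<Rightarrow> real"
  assumes fin: "finite J" and card: "card J = n" and n1: "n \<ge> 1"
    and k_meas [measurable]: "k \<in> borel_measurable borel"
    and k_nonneg: "\<And>\<rho>. \<rho> \<ge> 0 \<Longrightarrow> k \<rho> \<ge> 0" and k_le: "\<And>\<rho>. \<rho> \<ge> 0 \<Longrightarrow> k \<rho> \<le> 1 + \<rho>\<^sup>2"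
begin

abbreviation M where "M \<equiv> Pi\<^sub>M J (\<lambda>_. lborel :: real measure)"
abbreviation \<omega> where "\<omega> \<equiv> unit_ball_vol (real n)"

lemma measurable_norm [measurable]: "(\<lambda>y. L2_set y J) \<in> borel_measurable M"
  by (rule measurable_L2_set) simp

lemma norm_sets [measurable]: "{y \<in> space M. L2_set y J \<le> \<rho>} \<in> sets M" by measurable

lemma measure_ball: "\<rho> \<ge> 0 \<Longrightarrow> measure M {y \<in> space M. L2_set y J \<le> \<rho>} = \<omega> * \<rho> ^ n"
  using emeasure_L2_ball[OF fin card n1] by (simp add: measure_def)

lemma integrable_ball_mass:
  "integrable M (\<lambda>y. indicator {y. L2_set y J \<le> \<rho>} y * k (L2_set y J))"
proof (cases "\<rho> \<ge> 0")
  case True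
  have "integrable M (\<lambda>y. indicator {y \<in> space M. L2_set y J \<le> \<rho>} y * (1 + \<rho>\<^sup>2))"
    using emeasure_L2_ball[OF fin card n1 True]
    by (intro integrable_mult_left integrable_real_indicator) auto
  then show ?thesis
  proof (rule Bochner_Integration.integrable_bound)
    show "AE y in M. norm (indicator {y. L2_set y J \<le> \<rho>} y * k (L2_set y J))
       \<le> norm (indicator {y \<in> space M. L2_set y J \<le> \<rho>} y * (1 + \<rho>\<^sup>2))"
    proof (rule AE_I2)
      fix y assume y: "y \<in> space M"
      have "k (L2_set y J) \<le> 1 + \<rho>\<^sup>2" if "L2_set y J \<le> \<rho>"
        using k_le[of "L2_set y J"] power_mono[OF that, of 2] by simp
      then show "norm (indicator {y. L2_set y J \<le> \<rho>} y * k (L2_set y J))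
       \<le> norm (indicator {y \<in> space M. L2_set y J \<le> \<rho>} y * (1 + \<rho>\<^sup>2))"
        using y k_nonneg[of "L2_set y J"] by (auto split: split_indicator)
    qed
  qed measurable
next
  case False
  then have "indicator {y. L2_set y J \<le> \<rho>} y = (0::real)" for y
    using order_trans[OF L2_set_nonneg[of y J], of \<rho>] by (auto split: split_indicator)
  then show ?thesis by simp
qed

lemma nn_integral_ball_mass:
  "(\<integral>\<^sup>+y. ennreal (indicator {y. L2_set y J \<le> \<rho>} y * k (L2_set y J)) \<partial>M) = ennreal (ball_mass J k \<rho>)"
  unfolding ball_mass_def
  by (rule nn_integral_eq_integral[OF integrable_ball_mass]) (simp add: k_nonneg)

lemma ball_mass_nonneg: "ball_mass J k \<rho> \<ge> 0"
  unfolding ball_mass_def by (rule integral_nonneg_AE) (simp add: k_nonneg)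

lemma ball_mass_0: "ball_mass J k 0 = 0"
proof -
  have "{y \<in> space M. L2_set y J \<le> 0} \<in> null_sets M"
    using emeasure_L2_ball[OF fin card n1, of 0] n1 by (auto simp: null_sets_def zero_power)
  from AE_not_in[OF this]
  have "AE y in M. indicator {y. L2_set y J \<le> 0} y * k (L2_set y J) = 0"
    by (auto elim!: eventually_mono)
  then show ?thesis unfolding ball_mass_def by (rule integral_eq_zero_AE)
qed

lemma annulus:
  assumes ab: "0 \<le> a" "a \<le> b"
  shows "(\<And>\<rho>. a \<le> \<rho> \<Longrightarrow> \<rho> \<le> b \<Longrightarrow> c \<le> k \<rho>) \<Longrightarrow> \<omega> * (b ^ n - a ^ n) * c \<le> ball_mass J k b - ball_mass J k a"
    and "(\<And>\<rho>. a \<le> \<rho> \<Longrightarrow> \<rho> \<le> b \<Longrightarrow> k \<rho> \<le> c) \<Longrightarrow> ball_mass J k b - ball_mass J k a \<le> \<omega> * (b ^ n - a ^ n) * c"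
proof -
  let ?i = "\<lambda>\<rho> y. indicator {y \<in> space M. L2_set y J \<le> \<rho>} y :: real"
  let ?f = "\<lambda>\<rho> y. indicator {y. L2_set y J \<le> \<rho>} y * k (L2_set y J)"
  have i: "integrable M (?i \<rho>)" "(LINT y|M. ?i \<rho> y) = \<omega> * \<rho> ^ n" if "\<rho> \<ge> 0" for \<rho>
    using emeasure_L2_ball[OF fin card n1 that] measure_ball[OF that] by auto
  have 1: "ball_mass J k b - ball_mass J k a = (LINT y|M. ?f b y - ?f a y)"
    unfolding ball_mass_def by (rule Bochner_Integration.integral_diff[symmetric]) (rule integrable_ball_mass)+
  have 2: "\<omega> * (b ^ n - a ^ n) * c = (LINT y|M. (?i b y - ?i a y) * c)"
    using i[of a] i[of b] ab by (simp add: algebra_simps)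
  have int: "integrable M (\<lambda>y. (?i b y - ?i a y) * c)" "integrable M (\<lambda>y. ?f b y - ?f a y)"
    using i[of a] i[of b] ab by (auto intro: integrable_ball_mass)
  show "\<omega> * (b ^ n - a ^ n) * c \<le> ball_mass J k b - ball_mass J k a"
    if "\<And>\<rho>. a \<le> \<rho> \<Longrightarrow> \<rho> \<le> b \<Longrightarrow> c \<le> k \<rho>"
    unfolding 1 2 using ab that by (intro integral_mono int) (auto split: split_indicator)
  show "ball_mass J k b - ball_mass J k a \<le> \<omega> * (b ^ n - a ^ n) * c"
    if "\<And>\<rho>. a \<le> \<rho> \<Longrightarrow> \<rho> \<le> b \<Longrightarrow> k \<rho> \<le> c"
    unfolding 1 2 using ab that by (intro integral_mono int) (auto split: split_indicator)
qed

end

lemma radial_weight_gauss: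
  assumes "finite J" "card J = n" "n \<ge> 1" "q \<ge> 0"
  shows "radial_weight J n (\<lambda>\<rho>. exp (- q * \<rho>\<^sup>2))"
proof
  fix \<rho> :: real
  have "exp (- q * \<rho>\<^sup>2) \<le> 1" using assms(4) by simp
  then show "exp (- q * \<rho>\<^sup>2) \<le> 1 + \<rho>\<^sup>2" using zero_le_power2[of \<rho>] by linarith
qed (use assms in auto)

lemma radial_weight_square:
  assumes "finite J" "card J = n" "n \<ge> 1"
  shows "radial_weight J n (\<lambda>\<rho>. \<rho>\<^sup>2)"
  by standard (use assms in auto)

lemma radial_ball_mass:
  assumes "finite J" "card J = n" "n \<ge> 1" "q \<ge> 0"
  shows "radial n (unit_ball_vol (real n)) q (ball_mass J (\<lambda>\<rho>. exp (- q * \<rho>\<^sup>2)))"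
proof -
  interpret radial_weight J n "\<lambda>\<rho>. exp (- q * \<rho>\<^sup>2)" by (rule radial_weight_gauss[OF assms])
  show ?thesis
  proof
    fix a b :: real assume ab: "0 \<le> a" "a \<le> b"
    show "\<omega> * (b ^ n - a ^ n) * exp (- q * b\<^sup>2) \<le> ball_mass J (\<lambda>\<rho>. exp (- q * \<rho>\<^sup>2)) b - ball_mass J (\<lambda>\<rho>. exp (- q * \<rho>\<^sup>2)) a"
      by (rule annulus[OF ab]) (use ab assms in \<open>auto intro!: mult_left_mono power_mono\<close>)
    show "ball_mass J (\<lambda>\<rho>. exp (- q * \<rho>\<^sup>2)) b - ball_mass J (\<lambda>\<rho>. exp (- q * \<rho>\<^sup>2)) a \<le> \<omega> * (b ^ n - a ^ n) * exp (- q * a\<^sup>2)"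
      by (rule annulus[OF ab]) (use ab assms in \<open>auto intro!: mult_left_mono power_mono\<close>)
  qed (use assms ball_mass_0 in auto)
qed

lemma ball_mass_volume:
  assumes "finite J" "card J = n" "n \<ge> 1" "\<rho> \<ge> 0"
  shows "ball_mass J (\<lambda>\<rho>. exp (- 0 * \<rho>\<^sup>2)) \<rho> = unit_ball_vol (real n) * \<rho> ^ n"
proof -
  interpret radial n "unit_ball_vol (real n)" 0 "ball_mass J (\<lambda>\<rho>. exp (- 0 * \<rho>\<^sup>2))"
    by (rule radial_ball_mass) (use assms in auto)
  show ?thesis using step_lower[of 0 \<rho>] step_upper[of 0 \<rho>] assms G_0 by (simp add: zero_power)
qed

text \<open>At least half of the ball lies outside the concentric ball of half the radius.\<close>

lemma ball_mass_square_ge: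
  assumes "finite J" "card J = n" "n \<ge> 1" "\<rho> \<ge> 0"
  shows "unit_ball_vol (real n) * \<rho> ^ n * \<rho>\<^sup>2 / 8 \<le> ball_mass J (\<lambda>\<rho>. \<rho>\<^sup>2) \<rho>"
proof -
  interpret radial_weight J n "\<lambda>\<rho>. \<rho>\<^sup>2" by (rule radial_weight_square) (use assms in auto)
  have "\<rho> ^ n / 2 ^ n \<le> \<rho> ^ n / 2 ^ 1"
    using assms by (intro divide_left_mono power_increasing) auto
  then have "\<rho> ^ n / 2 \<le> \<rho> ^ n - (\<rho> / 2) ^ n"
    by (simp add: power_divide)
  then have "\<omega> * (\<rho> ^ n / 2) * (\<rho> / 2)\<^sup>2 \<le> \<omega> * (\<rho> ^ n - (\<rho> / 2) ^ n) * (\<rho> / 2)\<^sup>2"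
    by (intro mult_right_mono mult_left_mono) auto
  also have "\<dots> \<le> ball_mass J (\<lambda>\<rho>. \<rho>\<^sup>2) \<rho> - ball_mass J (\<lambda>\<rho>. \<rho>\<^sup>2) (\<rho> / 2)"
    by (rule annulus) (use assms in \<open>auto intro!: power_mono\<close>)
  also have "\<dots> \<le> ball_mass J (\<lambda>\<rho>. \<rho>\<^sup>2) \<rho>" using ball_mass_nonneg by simp
  finally show ?thesis by (simp add: power_divide)
qed

section \<open>Bodies of revolution: the law of the axial coordinate\<close>

text \<open>The case \<open>n = 0\<close> is excluded: there the fibres are points, and the second-moment bound alone
  settles it.\<close>

locale revolution = solid +
  fixes n :: nat and I :: "real set" and r :: "real \<Rightarrow> real"
  assumes d_eq: "d = Suc n" and n1: "n \<ge> 1"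
    and conc: "concave_on I r" and r_nonneg: "\<And>s. s \<in> I \<Longrightarrow> r s \<ge> 0"
    and K_eq: "K = {x \<in> Rd d. x 0 \<in> I \<and> L2_set x {1..<d} \<le> r (x 0)}"
    and comp: "compactin (powertop_real {..<d}) K"
    and iso: "isotropic_body d K"
begin

declare One_nat_def [simp del]

abbreviation J where "J \<equiv> {1..<d}"

lemma card_J: "card J = n" by (simp add: d_eq)

lemma d_pos: "0 < d" by (simp add: d_eq)

lemma ip_split: "ip d x x = (x 0)\<^sup>2 + (L2_set x J)\<^sup>2"
proof -
  have "ip d x x = (\<Sum>i\<in>insert 0 J. x i * x i)"
    unfolding ip_def by (rule sum.cong) (auto simp: d_eq)
  then show ?thesis by (simp add: L2_set_def sum_nonneg power2_eq_square)
qed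

definition fibre_mass :: "(real \<Rightarrow> real) \<Rightarrow> real \<Rightarrow> real" where
  "fibre_mass k s = (if s \<in> I then ball_mass J k (r s) else 0)"

text \<open>Fubini along the axis. With weights depending only on the axial coordinate and on the distance to
  the axis, the fibre over \<open>s\<close> contributes the weighted mass of a ball of radius \<open>r s\<close>. The measurability
  of the fibre mass, which involves the concave function \<open>r\<close>, comes out of Fubini as well.\<close>

lemma fibre_integration:
  assumes k: "radial_weight J n k" and g: "g \<in> borel_measurable borel" "\<And>s. g s \<ge> 0"
  shows "(\<lambda>s. ennreal (g s * fibre_mass k s)) \<in> borel_measurable borel" (is ?A)
    and "(\<integral>\<^sup>+x. ennreal (indicator K x * (g (x 0) * k (L2_set x J))) \<partial>N) =
         (\<integral>\<^sup>+s. ennreal (g s * fibre_mass k s) \<partial>lborel)" (is ?B)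
proof -
  interpret radial_weight J n k by (rule k)
  interpret product_sigma_finite "\<lambda>_::nat. lborel :: real measure" by standard
  interpret sM: sigma_finite_measure M by (rule sigma_finite) simp
  have ins: "insert 0 J = {..<d}" by (auto simp: d_eq)
  define f where "f = (\<lambda>x. ennreal (indicator K x * (g (x 0) * k (L2_set x J))))"
  note g(1) [measurable]
  have [measurable]: "(\<lambda>x. L2_set x J) \<in> borel_measurable N" by (rule measurable_L2_set) auto
  have [measurable]: "(\<lambda>x. x 0) \<in> borel_measurable N"
    by (auto intro!: measurable_component_singleton simp: d_eq)
  have f [measurable]: "f \<in> borel_measurable N" unfolding f_def by measurable
  have upd: "(\<lambda>p. (snd p)(0 := fst p)) \<in> lborel \<Otimes>\<^sub>M M \<rightarrow>\<^sub>M N"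
    by (rule measurable_fun_upd[where J = J]) (use ins in auto)
  have meas: "(\<lambda>s. \<integral>\<^sup>+y. f (y(0:=s)) \<partial>M) \<in> borel_measurable lborel"
    using measurable_compose[OF upd f] by (intro sM.borel_measurable_nn_integral) (simp add: case_prod_beta')
  have inner: "(\<integral>\<^sup>+y. f (y(0:=s)) \<partial>M) = ennreal (g s * fibre_mass k s)" for s
  proof -
    have "(\<integral>\<^sup>+y. f (y(0:=s)) \<partial>M) =
       (\<integral>\<^sup>+y. ennreal (g s * indicator I s) * ennreal (indicator {y. L2_set y J \<le> r s} y * k (L2_set y J)) \<partial>M)"
    proof (rule nn_integral_cong)
      fix y assume y: "y \<in> space M"
      have L: "L2_set (y(0:=s)) J = L2_set y J" by (rule L2_set_cong) auto
      have "y(0:=s) \<in> Rd d" using y ins by (auto simp: space_PiM PiE_iff extensional_def d_eq)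
      then have "y(0:=s) \<in> K \<longleftrightarrow> s \<in> I \<and> L2_set y J \<le> r s"
        using L by (simp add: K_eq)
      then show "f (y(0:=s)) = ennreal (g s * indicator I s) * ennreal (indicator {y. L2_set y J \<le> r s} y * k (L2_set y J))"
        using k_nonneg[of "L2_set y J"] g(2)[of s]
        by (simp add: f_def L ennreal_mult'[symmetric] split: split_indicator)
    qed
    also have "\<dots> = ennreal (g s * indicator I s) * ennreal (ball_mass J k (r s))"
      by (subst nn_integral_cmult) (use nn_integral_ball_mass in auto)
    finally show ?thesis
      using g(2)[of s] ball_mass_nonneg by (simp add: fibre_mass_def ennreal_mult'[symmetric])
  qed
  from meas show ?A unfolding inner by simp
  have "(\<integral>\<^sup>+x. f x \<partial>N) = (\<integral>\<^sup>+s. (\<integral>\<^sup>+y. f (y(0:=s)) \<partial>M) \<partial>lborel)"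
    using product_nn_integral_insert_rev[of J 0 f] f unfolding ins by simp
  then show ?B unfolding inner by (simp only: f_def)
qed

lemma fibre_mass_nonneg: "radial_weight J n k \<Longrightarrow> fibre_mass k s \<ge> 0"
  by (simp add: fibre_mass_def radial_weight.ball_mass_nonneg)

lemma fibre_mass_measurable:
  assumes "radial_weight J n k"
  shows "fibre_mass k \<in> borel_measurable borel"
proof -
  have "(\<lambda>s. enn2real (ennreal (1 * fibre_mass k s))) \<in> borel_measurable borel"
    using fibre_integration(1)[OF assms, of "\<lambda>_. 1"] by (intro measurable_compose[OF _ borel_measurable_enn2real]) auto
  then show ?thesis by (simp add: fibre_mass_nonneg[OF assms])
qed

lemma integral_fibre_mass:
  assumes k: "radial_weight J n k" and g: "g \<in> borel_measurable borel" "\<And>s. g s \<ge> 0"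
  shows "(LINT x|N. indicator K x * (g (x 0) * k (L2_set x J))) = (LINT s|lborel. g s * fibre_mass k s)"
proof -
  interpret radial_weight J n k by (rule k)
  note g(1) [measurable] fibre_mass_measurable[OF k, measurable]
  have [measurable]: "(\<lambda>x. L2_set x J) \<in> borel_measurable N" by (rule measurable_L2_set) auto
  have [measurable]: "(\<lambda>x. x 0) \<in> borel_measurable N"
    by (auto intro!: measurable_component_singleton simp: d_eq)
  have "(LINT x|N. indicator K x * (g (x 0) * k (L2_set x J))) =
     enn2real (\<integral>\<^sup>+x. ennreal (indicator K x * (g (x 0) * k (L2_set x J))) \<partial>N)"
    by (rule integral_eq_nn_integral) (auto simp: g k_nonneg)
  also have "\<dots> = (LINT s|lborel. g s * fibre_mass k s)"
    unfolding fibre_integration(2)[OF k g]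
    by (rule integral_eq_nn_integral[symmetric]) (auto simp: g fibre_mass_nonneg[OF k])
  finally show ?thesis .
qed

text \<open>The unnormalised density of the axial coordinate under the tilted measure.\<close>

definition F :: "real \<Rightarrow> real \<Rightarrow> real" where
  "F q s = exp (- q * s\<^sup>2) * fibre_mass (\<lambda>\<rho>. exp (- q * \<rho>\<^sup>2)) s"

abbreviation \<omega> where "\<omega> \<equiv> unit_ball_vol (real n)"
abbreviation G where "G q \<equiv> ball_mass J (\<lambda>\<rho>. exp (- q * \<rho>\<^sup>2))"

lemma weight: "q \<ge> 0 \<Longrightarrow> radial_weight J n (\<lambda>\<rho>. exp (- q * \<rho>\<^sup>2))"
  by (rule radial_weight_gauss[OF _ card_J n1]) auto

lemma radial_G: "q \<ge> 0 \<Longrightarrow> radial n \<omega> q (G q)"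
  by (rule radial_ball_mass[OF _ card_J n1]) auto

lemma F_measurable [measurable]: "q \<ge> 0 \<Longrightarrow> F q \<in> borel_measurable borel"
  unfolding F_def using fibre_mass_measurable[OF weight] by measurable

lemma F_nonneg: "q \<ge> 0 \<Longrightarrow> F q s \<ge> 0"
  unfolding F_def by (intro mult_nonneg_nonneg fibre_mass_nonneg weight) auto

lemma F_in: "s \<in> I \<Longrightarrow> F q s = exp (- q * s\<^sup>2) * G q (r s)"
  by (simp add: F_def fibre_mass_def)

lemma F_out: "s \<notin> I \<Longrightarrow> F q s = 0"
  by (simp add: F_def fibre_mass_def)

lemma F_0: "s \<in> I \<Longrightarrow> F 0 s = \<omega> * r s ^ n"
  using ball_mass_volume[OF _ card_J n1, of "r s"] r_nonneg by (simp add: F_in)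

lemma gauss_int_F:
  assumes q: "q \<ge> 0" and h: "h \<in> borel_measurable borel" "\<And>s. h s \<ge> 0"
  shows "gauss_int d K q (\<lambda>x. h (x 0)) = (LINT s|lborel. h s * F q s)"
proof -
  note h(1) [measurable]
  have "gauss_int d K q (\<lambda>x. h (x 0)) =
     (LINT x|N. indicator K x * ((h (x 0) * exp (- q * (x 0)\<^sup>2)) * exp (- q * (L2_set x J)\<^sup>2)))"
    unfolding gauss_int_def ip_split
    by (intro Bochner_Integration.integral_cong) (auto simp: algebra_simps exp_add[symmetric])
  also have "\<dots> = (LINT s|lborel. (h s * exp (- q * s\<^sup>2)) * fibre_mass (\<lambda>\<rho>. exp (- q * \<rho>\<^sup>2)) s)"
    by (rule integral_fibre_mass[OF weight[OF q]]) (use h in auto)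
  finally show ?thesis by (simp add: F_def mult.assoc)
qed

lemma axis_in_K: "s \<in> I \<Longrightarrow> 0 \<le> \<rho> \<Longrightarrow> \<rho> \<le> r s \<Longrightarrow> (\<lambda>i\<in>{..<d}. if i = 0 then s else if i = 1 then \<rho> else 0) \<in> K"
proof -
  assume s: "s \<in> I" "0 \<le> \<rho>" "\<rho> \<le> r s"
  let ?x = "\<lambda>i\<in>{..<d}. if i = 0 then s else if i = 1 then \<rho> else 0"
  have "(\<Sum>i\<in>J. (?x i)\<^sup>2) = (\<Sum>i\<in>J. if i = 1 then \<rho>\<^sup>2 else 0)"
    by (rule sum.cong) auto
  also have "\<dots> = \<rho>\<^sup>2" using n1 by (simp add: d_eq)
  finally have "L2_set ?x J = \<rho>" using s by (simp add: L2_set_def)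
  then show ?thesis using s by (simp add: K_eq d_eq)
qed

lemma I_bounded: "\<exists>B. I \<subseteq> {-B..B}"
proof -
  obtain B where B: "\<forall>x\<in>K. \<forall>i<d. \<bar>x i\<bar> \<le> B" using bounded_K by blast
  have "\<bar>s\<bar> \<le> B" if "s \<in> I" for s
    using B[rule_format, OF axis_in_K[OF that, of 0], of 0] r_nonneg[OF that] by (simp add: d_eq)
  then show ?thesis by (intro exI[of _ B]) (auto simp: abs_le_iff minus_le_iff)
qed

text \<open>Maximising \<open>r\<close> amounts to maximising the continuous function \<open>\<bar>y\<bar>\<^sup>2\<close> over the compact body.\<close>

lemma exists_widest: "\<exists>s0\<in>I. \<forall>s\<in>I. r s \<le> r s0"
proof -
  let ?\<phi> = "\<lambda>x::nat\<Rightarrow>real. \<Sum>i\<in>J. x i * x i"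
  have "continuous_map (powertop_real {..<d}) euclideanreal ?\<phi>"
    by (intro continuous_map_sum continuous_map_real_mult continuous_map_product_projection) auto
  then have "compact (?\<phi> ` K)" by (rule compact_continuous_real_image[OF comp])
  moreover have "?\<phi> ` K \<noteq> {}" using pos_K by auto
  ultimately obtain x where x: "x \<in> K" and max: "\<And>y. y \<in> K \<Longrightarrow> ?\<phi> y \<le> ?\<phi> x"
    using compact_attains_sup[of "?\<phi> ` K"] by auto
  have x0: "x 0 \<in> I" "L2_set x J \<le> r (x 0)" using x by (auto simp: K_eq)
  show ?thesis
  proof (intro bexI[of _ "x 0"] ballI)
    fix s assume s: "s \<in> I"
    let ?y = "\<lambda>i\<in>{..<d}. if i = 0 then s else if i = 1 then r s else 0"
    have "?\<phi> ?y = (\<Sum>i\<in>J. if i = 1 then r s * r s else 0)" by (rule sum.cong) auto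
    also have "\<dots> = (r s)\<^sup>2" using n1 by (simp add: d_eq power2_eq_square)
    finally have "(r s)\<^sup>2 \<le> ?\<phi> x"
      using max[OF axis_in_K[OF s, of "r s"]] r_nonneg[OF s] by simp
    also have "\<dots> = (L2_set x J)\<^sup>2" by (simp add: L2_set_def sum_nonneg power2_eq_square)
    also have "\<dots> \<le> (r (x 0))\<^sup>2" using x0 by (intro power_mono) auto
    finally show "r s \<le> r (x 0)" using r_nonneg[OF x0(1)] by (simp add: power2_le_iff_abs_le)
  qed (use x0 in auto)
qed

definition s0 where "s0 = (SOME s. s \<in> I \<and> (\<forall>t\<in>I. r t \<le> r s))"
definition R where "R = r s0"

lemma s0: "s0 \<in> I" and r_le_R: "s \<in> I \<Longrightarrow> r s \<le> R"
proof -
  have "s0 \<in> I \<and> (\<forall>t\<in>I. r t \<le> r s0)"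
    unfolding s0_def by (rule someI_ex) (use exists_widest in blast)
  then show "s0 \<in> I" "s \<in> I \<Longrightarrow> r s \<le> R" by (auto simp: R_def)
qed

lemma mid:
  assumes "s \<in> I" "t \<in> I"
  shows "(s + t) / 2 \<in> I" and "(r s + r t) / 2 \<le> r ((s + t) / 2)"
proof -
  have "convex I" using conc concave_on_imp_convex by blast
  then have "(1 - 1/2) *\<^sub>R s + (1/2) *\<^sub>R t \<in> I" using assms by (intro convexD_alt) auto
  then show "(s + t) / 2 \<in> I" by (simp add: add_divide_distrib)
  have "(1 - 1/2) * r s + (1/2) * r t \<le> r ((1 - 1/2) *\<^sub>R s + (1/2) *\<^sub>R t)"
    using assms conc by (intro concave_onD) auto
  then show "(r s + r t) / 2 \<le> r ((s + t) / 2)" by (simp add: add_divide_distrib)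
qed

lemma F_le: "q \<ge> 0 \<Longrightarrow> F q s \<le> G q R"
proof (cases "s \<in> I")
  assume q: "q \<ge> 0"
  interpret radial n \<omega> q "G q" by (rule radial_G[OF q])
  have GR: "G q R \<ge> 0" using r_nonneg[OF s0] by (intro G_nonneg) (simp add: R_def)
  {
    case True
    then have "F q s \<le> 1 * G q (r s)"
      unfolding F_in[OF True] using q r_nonneg by (intro mult_right_mono G_nonneg) auto
    also have "\<dots> \<le> G q R" unfolding mult_1 using True by (intro G_mono r_nonneg r_le_R)
    finally show ?thesis .
  next
    case False
    then show ?thesis using GR by (simp add: F_out)
  }
qed

lemma integrable_F:
  assumes q: "q \<ge> 0" and p: "continuous_on UNIV p"
  shows "integrable lborel (\<lambda>s. p s * F q s)"
proof -
  obtain B where B: "I \<subseteq> {-B..B}" using I_bounded by blast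
  have "compact (p ` {-B..B})"
    using p by (intro compact_continuous_image continuous_on_subset[OF p]) auto
  then have "\<exists>P. \<forall>s\<in>{-B..B}. \<bar>p s\<bar> \<le> P"
    using compact_imp_bounded[of "p ` {-B..B}"] by (simp add: bounded_iff)
  then obtain P where P: "\<And>s. s \<in> {-B..B} \<Longrightarrow> \<bar>p s\<bar> \<le> P" by blast
  have [measurable]: "p \<in> borel_measurable borel" using p by (rule borel_measurable_continuous_onI)
  have "integrable lborel (\<lambda>s. indicator {-B..B} s * (P * G q R))"
    by (intro integrable_mult_left integrable_real_indicator) (auto simp: emeasure_lborel_Icc_eq)
  then show ?thesis
  proof (rule Bochner_Integration.integrable_bound)
    show "AE s in lborel. norm (p s * F q s) \<le> norm (indicator {-B..B} s * (P * G q R))"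
    proof (rule AE_I2)
      fix s
      show "norm (p s * F q s) \<le> norm (indicator {-B..B} s * (P * G q R))"
      proof (cases "s \<in> I")
        case True
        then have s: "s \<in> {-B..B}" using B by auto
        have "norm (p s * F q s) = \<bar>p s\<bar> * F q s" using F_nonneg[OF q] by (simp add: abs_mult)
        also have "\<dots> \<le> P * G q R" using P[OF s] F_le[OF q] F_nonneg[OF q] by (intro mult_mono) auto
        also have "\<dots> \<le> \<bar>P * G q R\<bar>" by simp
        finally show ?thesis using s by simp
      qed (simp add: F_out)
    qed
    show "(\<lambda>s. p s * F q s) \<in> borel_measurable lborel" using q by measurable
  qed
qed

text \<open>Contraction by \<open>1/2\<close> towards \<open>c\<close>, as a substitution.\<close>

lemma half_subst:
  assumes q: "q \<ge> 0" and p: "continuous_on UNIV p"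
  shows "integrable lborel (\<lambda>s. p s * F q ((c + s) / 2))"
    and "(LINT s|lborel. p s * F q ((c + s) / 2)) = 2 * (LINT u|lborel. p (2 * u - c) * F q u)"
proof -
  have "integrable lborel (\<lambda>u. p (2 * u - c) * F q u)"
    by (rule integrable_F[OF q]) (intro continuous_on_compose2[OF p] continuous_intros; simp)
  from lborel_integrable_real_affine[OF this, of "1/2" "c/2"]
  show "integrable lborel (\<lambda>s. p s * F q ((c + s) / 2))" by (simp add: add_divide_distrib)
  show "(LINT s|lborel. p s * F q ((c + s) / 2)) = 2 * (LINT u|lborel. p (2 * u - c) * F q u)"
    using lborel_integral_real_affine[of "1/2" "\<lambda>u. p (2 * u - c) * F q u" "c/2"]
    by (simp add: add_divide_distrib)
qed

definition Z where "Z q = (LINT s|lborel. F q s)"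

lemma Z_gauss_int: "q \<ge> 0 \<Longrightarrow> Z q = gauss_int d K q (\<lambda>_. 1)"
  using gauss_int_F[of q "\<lambda>_. 1"] by (simp add: Z_def)

lemma Z_pos: "q \<ge> 0 \<Longrightarrow> Z q > 0"
  using gauss_int_one_pos by (simp add: Z_gauss_int)

lemma mean_F:
  assumes q: "q \<ge> 0"
  shows "(LINT s|lborel. (s - c)\<^sup>2 * F q s) = Z q * gauss_mean d K q (\<lambda>x. (x 0 - c)\<^sup>2)"
  using gauss_int_F[OF q, of "\<lambda>s. (s - c)\<^sup>2"] Z_pos[OF q] by (simp add: gauss_mean_def Z_gauss_int[OF q])

text \<open>Isotropy, expressed through second moments about arbitrary points \<open>c\<close> so that
  the integrands are nonnegative, as fibre integration requires.\<close>

lemma moment_F_0: "(LINT s|lborel. (s - c)\<^sup>2 * F 0 s) = Z 0 * (1 + c\<^sup>2)"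
proof -
  have 1: "gauss_mean d K 0 (\<lambda>x. x 0) = 0" "gauss_mean d K 0 (\<lambda>x. (x 0)\<^sup>2) = 1"
    using isotropic_moments(1,2)[OF iso, of "unitv 0"]
    by (simp_all add: ip_unitv d_pos) (simp_all add: unitv_def)
  have "gauss_mean d K 0 (\<lambda>x. (x 0 - c)\<^sup>2) = gauss_mean d K 0 (\<lambda>x. (x 0)\<^sup>2 - (2 * c * x 0 - c\<^sup>2))"
    by (simp add: power2_eq_square algebra_simps)
  also have "\<dots> = 1 + c\<^sup>2"
    by (simp add: mean_diff mean_cmult admissible_intros d_pos 1)
  finally show ?thesis using mean_F[of 0 c] by simp
qed

lemma R_pos: "R > 0"
proof (rule ccontr)
  assume "\<not> R > 0"
  then have "F 0 s = 0" for s
    using r_le_R[of s] r_nonneg[of s] n1 by (cases "s \<in> I") (auto simp: F_0 F_out)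
  then have "Z 0 = 0" by (simp add: Z_def)
  then show False using Z_pos[of 0] by simp
qed

end

section \<open>Bodies of revolution: variance bounds\<close>

context revolution
begin

lemma r_mid_widest:
  assumes "s \<in> I"
  shows "(s0 + s) / 2 \<in> I" "(R + r s) / 2 \<le> r ((s0 + s) / 2)"
  using mid[OF s0 assms] by (simp_all add: R_def)

lemma F_0_nonneg: "F 0 s \<ge> 0" by (simp add: F_nonneg)

lemma F_0_mid: "F 0 s \<le> F 0 ((s0 + s) / 2)"
proof (cases "s \<in> I")
  case True
  have "r s \<le> (R + r s) / 2" using r_le_R[OF True] by simp
  also have "\<dots> \<le> r ((s0 + s) / 2)" by (rule r_mid_widest(2)[OF True])
  finally have "r s \<le> r ((s0 + s) / 2)" .
  then show ?thesis using r_mid_widest(1)[OF True] True r_nonneg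
    by (simp add: F_0 mult_left_mono power_mono)
qed (simp add: F_out F_0_nonneg)

text \<open>The distance between mode and mean of a unimodal density is at most a multiple of the standard
  deviation. The test function \<open>(s + 2 * s0)\<^sup>2\<close> is chosen so that integrating
  \<open>F 0 s \<le> F 0 ((s0 + s) / 2)\<close> against it bounds \<open>s0\<close>: for \<open>(s - s0 - c)\<^sup>2\<close> the
  best choice is \<open>c = - 3 * s0\<close>.\<close>

lemma s0_sq_le: "s0\<^sup>2 \<le> 7 / 2"
proof -
  have "Z 0 * (1 + (- 2 * s0)\<^sup>2) = (LINT s|lborel. (s - (- 2 * s0))\<^sup>2 * F 0 s)"
    by (simp only: moment_F_0)
  also have "\<dots> \<le> (LINT s|lborel. (s - (- 2 * s0))\<^sup>2 * F 0 ((s0 + s) / 2))"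
    by (intro integral_mono integrable_F half_subst continuous_intros mult_left_mono F_0_mid) auto
  also have "\<dots> = 2 * (LINT u|lborel. (2 * u - s0 - (- 2 * s0))\<^sup>2 * F 0 u)"
    by (rule half_subst) (auto intro!: continuous_intros)
  also have "(LINT u|lborel. (2 * u - s0 - (- 2 * s0))\<^sup>2 * F 0 u) = (LINT u|lborel. 4 * ((u - (- s0 / 2))\<^sup>2 * F 0 u))"
    by (rule Bochner_Integration.integral_cong) (simp_all add: power2_eq_square algebra_simps)
  also have "\<dots> = 4 * (Z 0 * (1 + (- s0 / 2)\<^sup>2))"
    by (subst integral_mult_right_zero) (simp only: moment_F_0)
  finally have "Z 0 * (1 + 4 * s0\<^sup>2) \<le> Z 0 * (8 + 2 * s0\<^sup>2)"
    by (simp add: power_mult_distrib power_divide algebra_simps)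
  then show ?thesis using Z_pos[of 0] by simp
qed

text \<open>The mean of \<open>\<bar>y\<bar>\<^sup>2\<close> is \<open>n\<close>. After contraction towards the widest point every fibre has radius
  at least \<open>R / 2\<close> and at least the old one, so it contributes at least a constant times
  \<open>R\<^sup>2\<close> per unit of volume.\<close>

lemma R_sq_le: "R\<^sup>2 \<le> 64 * real n"
proof -
  let ?k = "\<lambda>\<rho>::real. \<rho>\<^sup>2"
  have k: "radial_weight J n ?k" by (rule radial_weight_square[OF _ card_J n1]) auto
  have x0: "gauss_mean d K 0 (\<lambda>x. (x 0)\<^sup>2) = 1"
    using isotropic_moments(2)[OF iso, of "unitv 0"]
    by (simp add: ip_unitv d_pos) (simp add: unitv_def)
  have "gauss_mean d K 0 (\<lambda>x. (L2_set x J)\<^sup>2) = gauss_mean d K 0 (\<lambda>x. ip d x x - (x 0)\<^sup>2)"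
    by (rule mean_cong) (simp add: ip_split)
  also have "\<dots> = n"
    using isotropic_moments(3)[OF iso] by (simp add: mean_diff admissible_intros d_pos x0) (simp add: d_eq)
  finally have "gauss_int d K 0 (\<lambda>x. (L2_set x J)\<^sup>2) = n * Z 0"
    using Z_pos[of 0] by (simp add: gauss_mean_def Z_gauss_int field_simps)
  moreover have "gauss_int d K 0 (\<lambda>x. (L2_set x J)\<^sup>2) = (LINT s|lborel. fibre_mass ?k s)"
    using integral_fibre_mass[OF k, of "\<lambda>_. 1"] by (simp add: gauss_int_def)
  ultimately have total: "(LINT s|lborel. fibre_mass ?k s) = n * Z 0" by simp
  have low: "R\<^sup>2 / 32 * F 0 s \<le> fibre_mass ?k ((s0 + s) / 2)" for s
  proof (cases "s \<in> I")
    case True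
    let ?m = "r ((s0 + s) / 2)"
    note mi = r_mid_widest[OF True]
    have "R / 2 \<le> (R + r s) / 2" "r s \<le> (R + r s) / 2"
      using r_le_R[OF True] r_nonneg[OF True] by simp_all
    then have m: "R / 2 \<le> ?m" "r s \<le> ?m" using mi(2) by (meson order_trans)+
    have "R\<^sup>2 / 32 * F 0 s = \<omega> * r s ^ n * (R / 2)\<^sup>2 / 8"
      by (simp add: F_0[OF True] power_divide)
    also have "\<dots> \<le> \<omega> * ?m ^ n * ?m\<^sup>2 / 8"
      using m r_nonneg[OF True] R_pos
      by (intro divide_right_mono mult_mono mult_left_mono power_mono) auto
    also have "\<dots> \<le> ball_mass J ?k ?m"
      by (rule ball_mass_square_ge[OF _ card_J n1 r_nonneg[OF mi(1)]]) simp
    finally show ?thesis using mi(1) by (simp add: fibre_mass_def)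
  qed (simp add: F_out fibre_mass_nonneg[OF k])
  have int: "integrable lborel (fibre_mass ?k)"
  proof (rule ccontr)
    assume "\<not> integrable lborel (fibre_mass ?k)"
    then have "n * Z 0 = 0" using total by (simp add: not_integrable_integral_eq)
    then show False using Z_pos[of 0] n1 by simp
  qed
  have "R\<^sup>2 / 32 * Z 0 = (LINT s|lborel. R\<^sup>2 / 32 * F 0 s)" by (simp add: Z_def)
  also have "\<dots> \<le> (LINT s|lborel. fibre_mass ?k ((s0 + s) / 2))"
    using lborel_integrable_real_affine[OF int, of "1/2" "s0/2"]
    by (intro integral_mono integrable_F low) (auto simp: add_divide_distrib)
  also have "\<dots> = 2 * (n * Z 0)"
    using lborel_integral_real_affine[of "1/2" "fibre_mass ?k" "s0/2"] total
    by (simp add: add_divide_distrib)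
  finally show ?thesis using Z_pos[of 0] by (simp add: field_simps)
qed

text \<open>With \<open>\<kappa>\<close> the ratio \<open>G q R / G 0 R\<close>, the growth bounds on \<open>G\<close> give
  \<open>\<kappa> * exp (- q * s\<^sup>2) * F 0 s \<le> F q s \<le> \<kappa> * sqrt (F 0 s * F 0 s0)\<close>. By concavity of \<open>r\<close>
  and the inequality of arithmetic and geometric means, the last square root is at most
  \<open>F 0 ((s0 + s) / 2)\<close>.\<close>

lemma small_tilt:
  assumes q: "0 \<le> q" "q \<le> 1 / 256"
  shows "gauss_mean d K q (\<lambda>x. (x 0 - 0)\<^sup>2) \<le> 16"
proof -
  interpret radial n \<omega> q "G q" by (rule radial_G[OF q(1)])
  define \<kappa> where "\<kappa> = G q R / (\<omega> * R ^ n)"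
  have \<kappa>: "\<kappa> > 0" unfolding \<kappa>_def using R_pos G_pos[OF R_pos] \<omega>_pos by simp
  have "\<omega> \<noteq> 0" using \<omega>_pos by linarith
  then have GR: "G q R = \<kappa> * \<omega> * R ^ n" using R_pos by (simp add: \<kappa>_def)
  have qR: "4 * q * R\<^sup>2 \<le> n"
  proof -
    have "4 * q * R\<^sup>2 \<le> 4 * (1 / 256) * (64 * real n)"
      using q R_sq_le by (intro mult_mono) auto
    then show ?thesis by simp
  qed
  have upper: "F q s \<le> \<kappa> * F 0 ((s0 + s) / 2)" for s
  proof (cases "s \<in> I")
    case True
    let ?m = "r ((s0 + s) / 2)"
    note mi = r_mid_widest[OF True]
    have rs: "0 \<le> r s" "r s \<le> R" using r_nonneg r_le_R True by auto
    \<comment> \<open>\<open>sqrt (R * r s) \<le> (R + r s) / 2 \<le> ?m\<close>\<close>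
    have "0 \<le> (R - r s)\<^sup>2" by simp
    then have "R * r s \<le> ((R + r s) / 2)\<^sup>2" by (simp add: power2_eq_square field_simps)
    also have "\<dots> \<le> ?m\<^sup>2" using mi(2) rs by (intro power_mono) auto
    finally have "(R * r s) ^ n \<le> (?m\<^sup>2) ^ n" using rs R_pos by (intro power_mono) auto
    then have am: "R ^ n * r s ^ n \<le> (?m ^ n)\<^sup>2" by (simp add: power_mult_distrib power_mult[symmetric] mult.commute)
    have "(G q (r s) * R ^ n)\<^sup>2 = ((G q (r s))\<^sup>2 * R ^ n) * R ^ n"
      by (simp add: power2_eq_square)
    also have "\<dots> \<le> ((G q R)\<^sup>2 * r s ^ n) * R ^ n"
      using G_ratio_sq_le[OF rs qR] R_pos by (intro mult_right_mono) auto
    also have "\<dots> = (G q R)\<^sup>2 * (R ^ n * r s ^ n)" by (simp add: mult_ac)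
    also have "\<dots> \<le> (G q R)\<^sup>2 * (?m ^ n)\<^sup>2" by (intro mult_left_mono am) auto
    finally have "(G q (r s) * R ^ n)\<^sup>2 \<le> (G q R * ?m ^ n)\<^sup>2" by (simp add: power_mult_distrib)
    then have "G q (r s) * R ^ n \<le> G q R * ?m ^ n"
      by (rule power2_le_imp_le) (use G_nonneg R_pos r_nonneg[OF mi(1)] in auto)
    also have "\<dots> = (\<kappa> * (\<omega> * ?m ^ n)) * R ^ n" unfolding GR by (simp only: mult_ac)
    finally have "G q (r s) \<le> \<kappa> * (\<omega> * ?m ^ n)" using R_pos by simp
    moreover have "F q s \<le> 1 * G q (r s)"
      unfolding F_in[OF True] using q rs by (intro mult_right_mono G_nonneg) auto
    ultimately show ?thesis by (simp add: F_0[OF mi(1)])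
  qed (use \<kappa> F_0_nonneg in \<open>simp add: F_out\<close>)
  have lower: "\<kappa> * (F 0 s - q * (s\<^sup>2 * F 0 s)) \<le> F q s" for s
  proof (cases "s \<in> I")
    case True
    have rs: "0 \<le> r s" "r s \<le> R" using r_nonneg r_le_R True by auto
    have "(\<kappa> * (\<omega> * r s ^ n)) * R ^ n = G q R * r s ^ n" unfolding GR by (simp only: mult_ac)
    also have "\<dots> \<le> G q (r s) * R ^ n" by (rule G_ratio_le[OF rs])
    finally have 1: "\<kappa> * F 0 s \<le> G q (r s)" using R_pos by (simp add: F_0[OF True])
    have 2: "1 - q * s\<^sup>2 \<le> exp (- q * s\<^sup>2)" using exp_ge_add_one_self[of "- q * s\<^sup>2"] by simp
    have "\<kappa> * (F 0 s - q * (s\<^sup>2 * F 0 s)) = (1 - q * s\<^sup>2) * (\<kappa> * F 0 s)" by (simp add: algebra_simps)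
    also have "\<dots> \<le> exp (- q * s\<^sup>2) * (\<kappa> * F 0 s)"
      using 2 \<kappa> F_0_nonneg by (intro mult_right_mono) auto
    also have "\<dots> \<le> exp (- q * s\<^sup>2) * G q (r s)" using 1 by (intro mult_left_mono) auto
    finally show ?thesis by (simp only: F_in[OF True])
  qed (simp add: F_out)
  have int0: "integrable lborel (F 0)" "integrable lborel (\<lambda>s. s\<^sup>2 * F 0 s)" "integrable lborel (F q)"
    "integrable lborel (\<lambda>s. s\<^sup>2 * F q s)"
    using integrable_F[of 0 "\<lambda>_. 1"] integrable_F[of q "\<lambda>_. 1"] q
    by (simp_all, (intro integrable_F continuous_intros; simp)+)
  have "(LINT s|lborel. s\<^sup>2 * F q s) \<le> (LINT s|lborel. \<kappa> * (s\<^sup>2 * F 0 ((s0 + s) / 2)))"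
  proof (rule integral_mono)
    show "integrable lborel (\<lambda>s. \<kappa> * (s\<^sup>2 * F 0 ((s0 + s) / 2)))"
      by (intro integrable_mult_right half_subst continuous_intros) auto
    show "s\<^sup>2 * F q s \<le> \<kappa> * (s\<^sup>2 * F 0 ((s0 + s) / 2))" for s
      using mult_left_mono[OF upper, of "s\<^sup>2" s] by (simp add: mult.left_commute)
  qed (use int0 in auto)
  also have "\<dots> = \<kappa> * (2 * (LINT u|lborel. (2 * u - s0)\<^sup>2 * F 0 u))"
    by (subst integral_mult_right_zero, subst half_subst) (auto intro!: continuous_intros)
  also have "(LINT u|lborel. (2 * u - s0)\<^sup>2 * F 0 u) = (LINT u|lborel. 4 * ((u - s0 / 2)\<^sup>2 * F 0 u))"
    by (rule Bochner_Integration.integral_cong) (simp_all add: power2_eq_square algebra_simps)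
  also have "\<dots> = 4 * (Z 0 * (1 + (s0 / 2)\<^sup>2))"
    by (subst integral_mult_right_zero) (simp only: moment_F_0)
  also have "\<dots> \<le> Z 0 * (15 / 2)"
    using s0_sq_le Z_pos[of 0] by (simp add: power_divide field_simps)
  finally have num: "(LINT s|lborel. s\<^sup>2 * F q s) \<le> \<kappa> * Z 0 * 15"
    using \<kappa> by simp
  have "\<kappa> * (Z 0 - q * Z 0) = (LINT s|lborel. \<kappa> * (F 0 s - q * (s\<^sup>2 * F 0 s)))"
    using int0 moment_F_0[of 0] by (simp add: Z_def)
  also have "\<dots> \<le> Z q"
    unfolding Z_def using int0 lower
    by (intro integral_mono Bochner_Integration.integrable_diff integrable_mult_right) auto
  finally have den: "\<kappa> * Z 0 * (1 - q) \<le> Z q" by (simp add: algebra_simps)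
  have "\<kappa> * Z 0 * 15 \<le> \<kappa> * Z 0 * (16 * (1 - q))"
    using q \<kappa> Z_pos[of 0] by (intro mult_left_mono) auto
  also have "\<dots> = 16 * (\<kappa> * Z 0 * (1 - q))" by (simp only: mult_ac)
  finally have "(LINT s|lborel. s\<^sup>2 * F q s) \<le> 16 * Z q" using num den by linarith
  then have "Z q * gauss_mean d K q (\<lambda>x. (x 0 - 0)\<^sup>2) \<le> Z q * 16"
    using mean_F[OF q(1), of 0] by simp
  then show ?thesis using Z_pos[OF q(1)] by simp
qed

lemma x_sq_exp_le_1:
  fixes x :: real assumes "x \<ge> 0" shows "x\<^sup>2 * exp (- 2 * x) \<le> 1"
proof -
  have "x \<le> exp x" using exp_ge_add_one_self[of x] by linarith
  then have "x\<^sup>2 \<le> (exp x)\<^sup>2" using assms by (intro power_mono) auto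
  also have "\<dots> = exp (2 * x)" by (simp add: exp_double)
  finally have "x\<^sup>2 * exp (- 2 * x) \<le> exp (2 * x) * exp (- 2 * x)" by (intro mult_right_mono) auto
  then show ?thesis by (simp add: exp_minus_inverse flip: exp_add)
qed

text \<open>Let \<open>s1\<close> be a point where \<open>F q\<close> is at least half its supremum. Log-concavity with the Gaussian
  gain gives \<open>F q s * F q s1 \<le> F q ((s1 + s) / 2)\<^sup>2 * exp (- q * (s - s1)\<^sup>2 / 2)\<close>. The
  exponential absorbs the factor \<open>(s - s1)\<^sup>2\<close> at the cost of a multiple of \<open>1 / q\<close>, and the contraction
  then bounds the second moment about \<open>s1\<close>.\<close>

lemma large_tilt:
  assumes q: "q \<ge> 1 / 256"
  shows "\<exists>c. gauss_mean d K q (\<lambda>x. (x 0 - c)\<^sup>2) \<le> 3072"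
proof -
  have q0: "q \<ge> 0" "q > 0" using q by auto
  interpret radial n \<omega> q "G q" by (rule radial_G[OF q0(1)])
  define S where "S = (SUP s. F q s)"
  have bdd: "bdd_above (range (F q))" using F_le[OF q0(1)] by (intro bdd_aboveI2) auto
  have le_S: "F q s \<le> S" for s unfolding S_def by (rule cSUP_upper[OF _ bdd]) auto
  have "\<exists>s. F q s > 0"
  proof (rule ccontr)
    assume "\<not> ?thesis"
    then have "F q s = 0" for s using F_nonneg[OF q0(1), of s] by (meson antisym not_le)
    then have "Z q = 0" by (simp add: Z_def)
    then show False using Z_pos[OF q0(1)] by simp
  qed
  then have "S > 0" using le_S less_le_trans by blast
  then have "S / 2 < S" by simp
  then obtain s1 where s1: "S / 2 < F q s1"
    unfolding S_def by (subst (asm) less_cSUP_iff[OF _ bdd]) auto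
  have s1I: "s1 \<in> I" using s1 \<open>S > 0\<close> F_out[of s1 q] by force
  have key: "(s - s1)\<^sup>2 * F q s \<le> 6 / q * F q ((s1 + s) / 2)" for s
  proof (cases "s \<in> I")
    case True
    let ?m = "(s1 + s) / 2"
    define x where "x = q * (s - s1)\<^sup>2 / 4"
    note mi = mid[OF s1I True]
    have x: "x \<ge> 0" unfolding x_def using q0 by simp
    have e: "exp (- q * s\<^sup>2) * exp (- q * s1\<^sup>2) = (exp (- q * ?m\<^sup>2))\<^sup>2 * exp (- 2 * x)"
      by (simp add: x_def flip: exp_add exp_double) (simp add: power2_eq_square field_simps)
    have "G q (r s) * G q (r s1) \<le> (G q ((r s1 + r s) / 2))\<^sup>2"
      using G_log_concave[of "r s1" "r s"] r_nonneg s1I True by (simp add: mult.commute)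
    also have "\<dots> \<le> (G q (r ?m))\<^sup>2"
      using mi r_nonneg[OF s1I] r_nonneg[OF True] by (intro power_mono G_mono G_nonneg) auto
    finally have g: "G q (r s) * G q (r s1) \<le> (G q (r ?m))\<^sup>2" .
    have "F q s * F q s1 = (exp (- q * s\<^sup>2) * exp (- q * s1\<^sup>2)) * (G q (r s) * G q (r s1))"
      unfolding F_in[OF True] F_in[OF s1I] by (simp only: mult_ac)
    also have "\<dots> \<le> (exp (- q * s\<^sup>2) * exp (- q * s1\<^sup>2)) * (G q (r ?m))\<^sup>2"
      using g by (intro mult_left_mono) auto
    also have "\<dots> = (F q ?m)\<^sup>2 * exp (- 2 * x)"
      unfolding e F_in[OF mi(1)] power_mult_distrib by (simp only: mult_ac)
    finally have f: "F q s * F q s1 \<le> (F q ?m)\<^sup>2 * exp (- 2 * x)" .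
    have "(F q s)\<^sup>2 \<le> F q s * (2 * F q s1)"
      unfolding power2_eq_square using le_S[of s] s1 F_nonneg[OF q0(1)] by (intro mult_left_mono) auto
    also have "\<dots> \<le> 2 * (F q ?m)\<^sup>2 * exp (- 2 * x)" using f by simp
    finally have f2: "(F q s)\<^sup>2 \<le> 2 * (F q ?m)\<^sup>2 * exp (- 2 * x)" .
    have h: "(s - s1)\<^sup>2 = 4 / q * x" unfolding x_def using q0 by simp
    have "((s - s1)\<^sup>2 * F q s)\<^sup>2 = (4 / q)\<^sup>2 * x\<^sup>2 * (F q s)\<^sup>2"
      unfolding h by (simp only: power_mult_distrib)
    also have "\<dots> \<le> (4 / q)\<^sup>2 * x\<^sup>2 * (2 * (F q ?m)\<^sup>2 * exp (- 2 * x))"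
      by (intro mult_left_mono f2) auto
    also have "\<dots> = (4 / q)\<^sup>2 * 2 * (F q ?m)\<^sup>2 * (x\<^sup>2 * exp (- 2 * x))"
      by (simp only: mult_ac)
    also have "\<dots> \<le> (4 / q)\<^sup>2 * 2 * (F q ?m)\<^sup>2 * 1"
      by (intro mult_left_mono x_sq_exp_le_1 x) auto
    also have "\<dots> \<le> (6 / q * F q ?m)\<^sup>2"
      by (simp add: power_mult_distrib power_divide divide_right_mono mult_right_mono)
    finally show ?thesis
      by (rule power2_le_imp_le) (use q0 F_nonneg[OF q0(1)] in auto)
  qed (use q0 F_nonneg[OF q0(1)] in \<open>simp add: F_out\<close>)
  have int: "integrable lborel (\<lambda>s. 1 * F q ((s1 + s) / 2))"
    by (rule half_subst[OF q0(1)]) auto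
  have "Z q * gauss_mean d K q (\<lambda>x. (x 0 - s1)\<^sup>2) = (LINT s|lborel. (s - s1)\<^sup>2 * F q s)"
    by (simp only: mean_F[OF q0(1)])
  also have "\<dots> \<le> (LINT s|lborel. 6 / q * (1 * F q ((s1 + s) / 2)))"
    by (intro integral_mono integrable_F[OF q0(1)] continuous_intros integrable_mult_right int) (use key in simp)
  also have "\<dots> = 6 / q * (2 * Z q)"
    by (subst integral_mult_right_zero, subst half_subst[OF q0(1)]) (auto simp: Z_def)
  finally have "Z q * gauss_mean d K q (\<lambda>x. (x 0 - s1)\<^sup>2) \<le> Z q * (12 / q)" by (simp add: mult.commute)
  then have "gauss_mean d K q (\<lambda>x. (x 0 - s1)\<^sup>2) \<le> 12 / q"
    using Z_pos[OF q0(1)] by (simp only: mult_le_cancel_left_pos)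
  also have "\<dots> \<le> 3072" using q q0 by (simp add: field_simps)
  finally show ?thesis by blast
qed

lemma axis_variance: 
  assumes "q > 0" shows "Cov q 0 0 \<le> 3072"
proof (cases "q \<le> 1 / 256")
  case True
  then have "gauss_mean d K q (\<lambda>x. (x 0 - 0)\<^sup>2) \<le> 16" using assms by (intro small_tilt) auto
  then show ?thesis using Cov_self_le[OF d_pos, of q 0] by linarith
next
  case False
  then obtain c where "gauss_mean d K q (\<lambda>x. (x 0 - c)\<^sup>2) \<le> 3072" using large_tilt[of q] by auto
  then show ?thesis using Cov_self_le[OF d_pos, of q c] by linarith
qed

text \<open>The reflection fixes the axis and, being an isometry, preserves the distance to it.\<close>

lemma reflect_in_K:
  assumes x: "x \<in> K" and u: "u 0 = 0" "ip d u u = 1"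
  shows "reflect d u 0 x \<in> K"
proof -
  have 0: "reflect d u 0 x 0 = x 0" using u d_pos by (simp add: reflect_def)
  have "(L2_set (reflect d u 0 x) J)\<^sup>2 = (L2_set x J)\<^sup>2"
    using ip_reflect_self[OF u(2), of x] ip_split[of x] ip_split[of "reflect d u 0 x"] 0 by simp
  then have "L2_set (reflect d u 0 x) J = L2_set x J" by (simp add: power2_eq_iff_nonneg)
  moreover have "reflect d u 0 x \<in> Rd d" by (simp add: reflect_def)
  ultimately show ?thesis using x 0 by (simp add: K_eq)
qed

lemma flip_in_K: "x \<in> K \<Longrightarrow> 0 < i \<Longrightarrow> i < d \<Longrightarrow> reflect d (unitv i) 0 x \<in> K"
  by (rule reflect_in_K) (simp_all add: ip_unitv, simp_all add: unitv_def)

text \<open>Symmetry under the exchange of two transverse coordinates, which is the reflection along their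
  normalised difference.\<close>

lemma transverse_second_moment_eq:
  assumes i: "0 < i" "i < d" and j: "0 < j" "j < d"
  shows "gauss_mean d K q (\<lambda>x. (x i)\<^sup>2) = gauss_mean d K q (\<lambda>x. (x j)\<^sup>2)"
proof (cases "i = j")
  case False
  define u where "u = (\<lambda>l. 1 / sqrt 2 * (unitv i l - unitv j l))"
  have ipu: "ip d x u = 1 / sqrt 2 * (x i - x j)" for x
    unfolding u_def using i j by (simp only: ip_scale_right ip_diff_right ip_unitv)
  have uu: "ip d u u = 1"
    unfolding ipu using False by (simp add: u_def unitv_def)
  have inv: "reflect d u 0 x \<in> K" if "x \<in> K" for x
    using that i j uu by (intro reflect_in_K) (auto simp: u_def unitv_def)
  let ?w = "\<lambda>l. unitv i l + unitv j l"
  have ipw: "ip d x ?w = x i + x j" for x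
  proof -
    have "ip d x ?w = ip d x (unitv i) + ip d x (unitv j)"
      by (simp add: ip_def distrib_left sum.distrib)
    then show ?thesis using i j by (simp add: ip_unitv)
  qed
  have "gauss_mean d K q (\<lambda>x. ip d x ?w * ip d x u) = 0"
    using mean_reflect_orthogonal(2)[OF uu inv, of q ?w] False by (simp add: ipu unitv_def)
  then have "0 = gauss_mean d K q (\<lambda>x. ip d x ?w * ip d x u)" by (rule sym)
  also have "\<dots> = gauss_mean d K q (\<lambda>x. 1 / sqrt 2 * ((x i)\<^sup>2 - (x j)\<^sup>2))"
    unfolding ipw ipu by (rule mean_cong) (simp add: power2_eq_square field_simps)
  also have "\<dots> = 1 / sqrt 2 * (gauss_mean d K q (\<lambda>x. (x i)\<^sup>2) - gauss_mean d K q (\<lambda>x. (x j)\<^sup>2))"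
    using i j by (subst mean_cmult, subst mean_diff) (simp_all add: admissible_intros)
  finally show ?thesis by simp
qed simp

lemma transverse_second_moment_le:
  assumes q: "q > 0" and i: "0 < i" "i < d"
  shows "gauss_mean d K q (\<lambda>x. (x i)\<^sup>2) \<le> 2"
proof -
  have "real n * gauss_mean d K q (\<lambda>x. (x i)\<^sup>2) = (\<Sum>j\<in>J. gauss_mean d K q (\<lambda>x. (x j)\<^sup>2))"
  proof -
    have "(\<Sum>j\<in>J. gauss_mean d K q (\<lambda>x. (x j)\<^sup>2)) = (\<Sum>j\<in>J. gauss_mean d K q (\<lambda>x. (x i)\<^sup>2))"
      by (rule sum.cong[OF refl], rule transverse_second_moment_eq) (use i in \<open>auto simp: One_nat_def\<close>)
    then show ?thesis by (simp only: sum_constant card_J)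
  qed
  also have "\<dots> = gauss_mean d K q (\<lambda>x. \<Sum>j\<in>J. (x j)\<^sup>2)"
    by (subst mean_sum) (auto intro!: admissible_power admissible_coord)
  also have "\<dots> \<le> gauss_mean d K q (\<lambda>x. ip d x x)"
  proof (rule mean_mono)
    show "(\<Sum>j\<in>J. (x j)\<^sup>2) \<le> ip d x x" for x by (simp add: ip_split L2_set_def sum_nonneg)
    show "admissible d K (\<lambda>x. \<Sum>j\<in>J. (x j)\<^sup>2)" by (auto intro!: admissible_sum admissible_power admissible_coord)
  qed (rule admissible_ip_self)
  also have "\<dots> \<le> real n + 1"
    using mean_ip_self_le[of q] q isotropic_moments(3)[OF iso] by (simp add: d_eq)
  also have "\<dots> \<le> real n * 2" using n1 by simp
  finally show ?thesis using n1 by simp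
qed

lemma stable: "quadratic_tilt_stable d 3072 (uniform_on d K)"
proof (rule quadratic_tilt_stableI)
  fix q i j assume "i < d" "j < d" "i \<noteq> j"
  then show "Cov q i j = 0"
    using Cov_flip(2)[of i j q] Cov_flip(2)[of j i q] flip_in_K by (cases "i = 0") auto
next
  fix q :: real and i assume q: "q > 0" and i: "i < d"
  show "Cov q i i \<le> 3072"
  proof (cases "i = 0")
    case True
    then show ?thesis using axis_variance[OF q] by simp
  next
    case False
    then show ?thesis
      using Cov_flip(1)[OF i flip_in_K, of q] transverse_second_moment_le[OF q _ i] i by simp
  qed
qed simp

end

lemma quadratic_tilt_stable_mono:
  "quadratic_tilt_stable d c M \<Longrightarrow> c \<le> c' \<Longrightarrow> quadratic_tilt_stable d c' M"
  unfolding quadratic_tilt_stable_def by force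

lemma one_dim_stable:
  assumes iso: "isotropic_body 1 K"
  shows "quadratic_tilt_stable 1 1 (uniform_on 1 K)"
proof -
  interpret solid 1 K by (rule solid_isotropic[OF iso]) simp
  show ?thesis
  proof (rule quadratic_tilt_stableI)
    fix q :: real and i assume q: "q > 0" and i: "i < (1::nat)"
    have "Cov q i i \<le> gauss_mean 1 K q (\<lambda>x. (x i - 0)\<^sup>2)" by (rule Cov_self_le[OF i])
    also have "\<dots> = gauss_mean 1 K q (\<lambda>x. ip 1 x x)"
      using i by (intro mean_cong) (simp add: ip_def power2_eq_square)
    also have "\<dots> \<le> 1"
      using mean_ip_self_le[of q] q isotropic_moments(3)[OF iso] by simp
    finally show "Cov q i i \<le> 1" .
  qed auto
qed

lemma revolution_stable:
  assumes d: "d \<ge> 1" and rev: "convex_body_of_revolution d K" and iso: "isotropic_body d K"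
  shows "quadratic_tilt_stable d 3072 (uniform_on d K)"
proof (cases "d = 1")
  case True
  then show ?thesis using quadratic_tilt_stable_mono[OF one_dim_stable] iso by simp
next
  case False
  obtain I r where I: "concave_on I r" "\<forall>s\<in>I. r s \<ge> 0"
    and K: "K = {x \<in> Rd d. x 0 \<in> I \<and> L2_set x {1..<d} \<le> r (x 0)}"
    using rev by (auto simp: convex_body_of_revolution_def)
  interpret solid d K by (rule solid_isotropic[OF iso d])
  interpret revolution d K "d - 1" I r
  proof
    show "compactin (powertop_real {..<d}) K" using iso by (simp add: isotropic_body_def convex_body_def)
  qed (use I K iso d False in auto)
  show ?thesis by (rule stable)
qed

section \<open>The uniform bound\<close>

theorem mainTheorem11:
  shows "\<exists>C>0. \<forall>d\<ge>1. \<forall>K.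
    (K = isotropic_cube d \<or>
     (regular_simplex d K \<and> isotropic_body d K) \<or>
     (convex_body_of_revolution d K \<and> isotropic_body d K))
    \<longrightarrow> quadratic_tilt_stable d C (uniform_on d K)"
proof (intro exI[of _ 3072] conjI allI impI)
  fix d :: nat and K
  assume d: "d \<ge> 1"
    and "K = isotropic_cube d \<or> (regular_simplex d K \<and> isotropic_body d K) \<or>
     (convex_body_of_revolution d K \<and> isotropic_body d K)"
  then consider "K = isotropic_cube d" | "regular_simplex d K" "isotropic_body d K"
    | "convex_body_of_revolution d K" "isotropic_body d K" by blast
  then show "quadratic_tilt_stable d 3072 (uniform_on d K)"
  proof cases
    case 1
    then show ?thesis using quadratic_tilt_stable_mono[OF cube_stable] by simp
  next
    case 2
    then show ?thesis using quadratic_tilt_stable_mono[OF simplex_stable[OF d]] by simp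
  next
    case 3
    then show ?thesis using revolution_stable[OF d] by simp
  qed
qed simp

end
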